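(* Let $A$ be the adjacency matrix of a random graph from the inhomogeneous Erd\H{o}s–R\'enyi model $G(n,(p_{ij}))$, let $d=\max_{i,j}np_{ij}$ and $d_{\min}=\min_i\sum_jp_{ij}$, and choose $\gamma>0$. Then there is an absolute constant $C$ such that for any $r\ge1$, with probability at least $1-e^{-r}$, $$\|L_{sym,\gamma}-\overline{L_{sym}}\|\le\frac{Cr^2}{\sqrt\gamma}\left(1+\frac d\gamma\right)^{5/2}+3\sqrt{\frac{\gamma}{d_{\min}+\gamma}}.$$
   Context: Inhomogeneous Erd\H{o}s–R\'enyi model: a symmetric $0/1$ matrix $A$ whose entries $A_{ij}$, $i\le j$, are independent Bernoulli$(p_{ij})$. Regularization: $A_\gamma=A+\frac\gamma n\mathbf1\mathbf1^\top$, $D_\gamma=\mathrm{diag}(A_\gamma\mathbf1)$, $L_{sym,\gamma}=I-D_\gamma^{-1/2}A_\gamma D_\gamma^{-1/2}$. Expected (unregularized) normalized Laplacian: $\bar A=\mathbb EA$, $\bar D=\mathrm{diag}(\bar A\mathbf1)$, $\overline{L_{sym}}=I-\bar D^{-1/2}\bar A\bar D^{-1/2}$ (assuming $d_{\min}>0$). $\|\cdot\|$ spectral norm. *)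

theory Defs
  imports "HOL-Probability.Probability"
begin

text \<open>Matrices of size n x n are represented as functions nat => nat => real,
  only the entries with indices below n being relevant.\<close>

definition ER_edges :: "nat \<Rightarrow> (nat \<Rightarrow> nat \<Rightarrow> real) \<Rightarrow> (nat \<times> nat \<Rightarrow> bool) pmf" where
  "ER_edges n p = Pi_pmf {(i, j). i \<le> j \<and> j < n} False (\<lambda>(i, j). bernoulli_pmf (p i j))"

definition adj_of_edges :: "nat \<Rightarrow> (nat \<times> nat \<Rightarrow> bool) \<Rightarrow> nat \<Rightarrow> nat \<Rightarrow> real" where
  "adj_of_edges n e i j =
     (if i < n \<and> j < n \<and> e (min i j, max i j) then 1 else 0)"

definition ER_adj :: "nat \<Rightarrow> (nat \<Rightarrow> nat \<Rightarrow> real) \<Rightarrow> (nat \<Rightarrow> nat \<Rightarrow> real) pmf" where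
  "ER_adj n p = map_pmf (adj_of_edges n) (ER_edges n p)"

definition reg_adj :: "nat \<Rightarrow> real \<Rightarrow> (nat \<Rightarrow> nat \<Rightarrow> real) \<Rightarrow> nat \<Rightarrow> nat \<Rightarrow> real" where
  "reg_adj n \<gamma> A i j = A i j + \<gamma> / real n"

definition row_deg :: "nat \<Rightarrow> (nat \<Rightarrow> nat \<Rightarrow> real) \<Rightarrow> nat \<Rightarrow> real" where
  "row_deg n M i = (\<Sum>j<n. M i j)"

definition sym_lap :: "nat \<Rightarrow> (nat \<Rightarrow> nat \<Rightarrow> real) \<Rightarrow> nat \<Rightarrow> nat \<Rightarrow> real" where
  "sym_lap n M i j =
     (if i = j then 1 else 0) - M i j / (sqrt (row_deg n M i) * sqrt (row_deg n M j))"

definition spec_norm :: "nat \<Rightarrow> (nat \<Rightarrow> nat \<Rightarrow> real) \<Rightarrow> real" where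
  "spec_norm n M = (SUP x\<in>{x :: nat \<Rightarrow> real. (\<Sum>i<n. (x i)\<^sup>2) \<le> 1}.
                      sqrt (\<Sum>i<n. (\<Sum>j<n. M i j * x j)\<^sup>2))"

end

theory Submission
  imports Defs "HOL-Library.Log_Nat"
begin

text \<open>
  Both normalized adjacency matrices have norm at most 1, so the claim is only of interest when its
  right-hand side is below 2, and then \<open>r + 1 \<le> \<gamma> \<le> d \<le> n\<close>. With \<open>D\<close> the regularized random degrees
  and \<open>E\<close> the regularized expected ones, the difference splits as
  \<open>D\<^bsup>-1/2\<^esup> (A - p) D\<^bsup>-1/2\<^esup> + (D\<^bsup>-1/2\<^esup> p\<^sub>\<gamma> D\<^bsup>-1/2\<^esup> - E\<^bsup>-1/2\<^esup> p\<^sub>\<gamma> E\<^bsup>-1/2\<^esup>) + bias\<close>.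

  The bias is deterministic and at most \<open>3 \<gamma> / (d\<^sub>m\<^sub>i\<^sub>n + \<gamma>)\<close>. The middle term is bounded in
  Frobenius norm by the fluctuation of the degrees, whose square sum is controlled by Markov's inequality for
  the average of \<open>exp (\<bar>deg i - E deg i\<bar> / (2 sqrt d))\<close>.

  The first term is handled in the manner of Feige and Ofek. The substitution \<open>u = sqrt (n \<gamma>) D\<^bsup>-1/2\<^esup> x\<close> turns
  a unit vector into a vector with \<open>\<Sum>u\<^sub>i\<^sup>2 \<le> n\<close> and \<open>\<Sum>deg\<^sub>i u\<^sub>i\<^sup>2 \<le> n \<gamma>\<close>, and rounding to the integer lattice
  preserves both bounds up to constants. Pairs with \<open>\<bar>X\<^sub>i Y\<^sub>j\<bar> \<le> sqrt d\<close> obey a Bernstein bound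
  uniformly over the \<open>48\<^sup>n\<close> lattice points. The remaining pairs are grouped into dyadic levels: if the ratio
  of \<open>\<bar>X\<^sub>i\<bar>\<close> and \<open>\<bar>Y\<^sub>j\<bar>\<close> exceeds \<open>sqrt d\<close>, the weighted degree bound suffices, and otherwise a
  uniform Chernoff bound on the edges between two level sets does, its exponential tilt being the
  logarithm of \<open>\<bar>X\<^sub>i Y\<^sub>j\<bar> / sqrt d\<close>.
\<close>

section \<open>Exponential moments of the adjacency matrix\<close>

text \<open>Only the entries with \<open>i \<le> j\<close> are independent, so exponential moments
  factor over the upper triangle. Folding the square lets weights be given for ordered
  pairs.\<close>

lemma sum_square_upper_triangle:
  fixes f :: "nat \<Rightarrow> nat \<Rightarrow> real"
  shows "(\<Sum>i<n. \<Sum>j<n. f i j) =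
    (\<Sum>(i, j)\<in>{(i, j). i \<le> j \<and> j < n}. if i = j then f i i else f i j + f j i)"
proof (induction n)
  case (Suc n)
  let ?g = "\<lambda>(i, j). if i = j then f i i else f i j + f j i"
  have fin: "finite {(i, j). i \<le> j \<and> j < n}" 
    by (rule finite_subset[of _ "{..<n} \<times> {..<n}"]) auto
  have dec: "{(i, j). i \<le> j \<and> j < Suc n} = {(i, j). i \<le> j \<and> j < n} \<union> (\<lambda>i. (i, n)) ` {..n}"
    by (auto simp: less_Suc_eq)
  have "sum ?g {(i, j). i \<le> j \<and> j < Suc n} = sum ?g {(i, j). i \<le> j \<and> j < n} + sum ?g ((\<lambda>i. (i, n)) ` {..n})"
    unfolding dec by (rule sum.union_disjoint) (use fin in auto)
  also have "sum ?g ((\<lambda>i. (i, n)) ` {..n}) = (\<Sum>i\<le>n. ?g (i, n))"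
    by (subst sum.reindex) (auto simp: inj_on_def)
  also have "\<dots> = (\<Sum>i<n. f i n + f n i) + f n n"
    by (simp add: lessThan_Suc_atMost[symmetric])
  finally show ?case using Suc by (simp add: sum.distrib)
qed simp

text \<open>This is \<open>2 * exp a * exp b \<le> exp (2 * a) + exp (2 * b)\<close>. It decouples
  the two weights \<open>w i j\<close> and \<open>w j i\<close> that act on the same edge, at the
  price of doubling the exponents.\<close>

lemma exp_sum_minus_one_le: "exp (a + b) - 1 \<le> (exp (2 * a) - 1) / 2 + (exp (2 * b) - 1) / (2::real)"
proof -
  have "0 \<le> (exp a - exp b)\<^sup>2" by simp
  then have "2 * (exp a * exp b) \<le> exp a * exp a + exp b * exp b"
    by (simp add: power2_eq_square algebra_simps)
  then show ?thesis unfolding mult_2 exp_add by (simp add: field_simps)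
qed

lemma exp_minus_one_le: "exp a - 1 \<le> (exp (2 * a) - 1) / (2::real)"
  using exp_sum_minus_one_le[of a 0] by simp

text \<open>For \<open>x = - t < 0\<close> combine \<open>exp (- t) \<le> 1 / (1 + t)\<close> with
  \<open>(1 - t + t^2) * (1 + t) = 1 + t^3 \<ge> 1\<close>.\<close>

lemma exp_le_quadratic:
  fixes x :: real
  assumes "\<bar>x\<bar> \<le> 1"
  shows "exp x \<le> 1 + x + x\<^sup>2"
proof (cases "x \<ge> 0")
  case False
  define t where "t = - x"
  have t: "0 < t" using False by (simp add: t_def)
  have "1 \<le> 1 + t ^ 3" using t by simp
  also have "\<dots> = (1 - t + t\<^sup>2) * (1 + t)" by (simp add: algebra_simps power2_eq_square power3_eq_cube)
  finally have "1 / (1 + t) \<le> 1 - t + t\<^sup>2" using t by (simp add: divide_le_eq)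
  moreover have "exp (- t) \<le> 1 / (1 + t)"
    using exp_ge_add_one_self[of t] t by (simp add: exp_minus field_simps)
  ultimately show ?thesis by (simp add: t_def)
qed (use assms exp_bound in auto)

text \<open>Here \<open>d\<close> is any number with \<open>p i j \<le> d / n\<close>, not
  necessarily the maximum. The bound \<open>1 \<le> d\<close> is available where the locale is
  interpreted, because there \<open>r + 1 \<le> \<gamma> \<le> d\<close>.\<close>

locale inhom_ER =
  fixes n :: nat and p :: "nat \<Rightarrow> nat \<Rightarrow> real" and d :: real
  assumes n_pos: "n \<ge> 1"
    and p_nonneg: "\<And>i j. i < n \<Longrightarrow> j < n \<Longrightarrow> 0 \<le> p i j"
    and p_le_1: "\<And>i j. i < n \<Longrightarrow> j < n \<Longrightarrow> p i j \<le> 1"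
    and p_sym: "\<And>i j. i < n \<Longrightarrow> j < n \<Longrightarrow> p i j = p j i"
    and p_le: "\<And>i j. i < n \<Longrightarrow> j < n \<Longrightarrow> p i j \<le> d / n"
    and d_ge_1: "1 \<le> d"
begin

section \<open>Support and entries of the random adjacency matrix\<close>

lemma finite_edges: "finite {(i::nat, j). i \<le> j \<and> j < n}"
  by (rule finite_subset[of _ "{..<n} \<times> {..<n}"]) auto

lemma finite_set_ER_edges: "finite (set_pmf (ER_edges n p))"
proof -
  have "set_pmf (ER_edges n p) \<subseteq> PiE_dflt {(i, j). i \<le> j \<and> j < n} False (\<lambda>_. UNIV)"
    unfolding ER_edges_def using set_Pi_pmf_subset[OF finite_edges]
    by (fastforce simp: PiE_dflt_def)
  then show ?thesis by (rule finite_subset) (intro finite_PiE_dflt finite_edges, simp)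
qed

lemma finite_set_ER_adj: "finite (set_pmf (ER_adj n p))"
  using finite_set_ER_edges by (simp add: ER_adj_def)

lemma integrable_ER_adj [simp]: "integrable (measure_pmf (ER_adj n p)) (f :: _ \<Rightarrow> real)"
  by (rule integrable_measure_pmf_finite[OF finite_set_ER_adj])

lemma ER_adj_entry: "A \<in> set_pmf (ER_adj n p) \<Longrightarrow> A i j = 0 \<or> A i j = 1"
  by (auto simp: ER_adj_def adj_of_edges_def)

lemma ER_adj_sym: "A \<in> set_pmf (ER_adj n p) \<Longrightarrow> A i j = A j i"
  by (auto simp: ER_adj_def adj_of_edges_def min.commute[of i j] max.commute[of i j])

lemma ER_adj_nonneg: "A \<in> set_pmf (ER_adj n p) \<Longrightarrow> 0 \<le> A i j"
  by (metis ER_adj_entry order_refl zero_le_one)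

lemma row_deg_ER_adj_nonneg: "A \<in> set_pmf (ER_adj n p) \<Longrightarrow> 0 \<le> row_deg n A i"
  by (simp add: row_deg_def sum_nonneg ER_adj_nonneg)

text \<open>By independence the expectation is a product over edges, and a Bernoulli factor is
  \<open>1 + q * (exp c - 1) \<le> exp (q * (exp c - 1))\<close>. Decoupling
  \<open>c = w i j + w j i\<close> returns a sum over ordered pairs. Since \<open>w\<close> is an
  arbitrary matrix, the bound applies to single rows, to blocks \<open>S \<times> T\<close> and to
  rank-one weights alike.\<close>

lemma mgf_le:
  "measure_pmf.expectation (ER_adj n p) (\<lambda>A. exp (\<Sum>i<n. \<Sum>j<n. w i j * A i j))
     \<le> exp ((\<Sum>i<n. \<Sum>j<n. p i j * (exp (2 * w i j) - 1)) / 2)"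
proof -
  let ?I = "{(i::nat, j). i \<le> j \<and> j < n}"
  \<comment> \<open>\<open>c\<close> is the total weight of an undirected edge; a diagonal entry is
    counted once.\<close>
  define c where "c = (\<lambda>(i, j). if i = j then w i i else w i j + w j i)"
  have eq: "(\<Sum>i<n. \<Sum>j<n. w i j * adj_of_edges n e i j) = (\<Sum>ij\<in>?I. c ij * of_bool (e ij))" for e
    unfolding sum_square_upper_triangle
    by (rule sum.cong) (auto simp: c_def adj_of_edges_def algebra_simps min_def max_def)
  have "measure_pmf.expectation (ER_adj n p) (\<lambda>A. exp (\<Sum>i<n. \<Sum>j<n. w i j * A i j))
      = measure_pmf.expectation (ER_edges n p) (\<lambda>e. \<Prod>ij\<in>?I. exp (c ij * of_bool (e ij)))"
    unfolding ER_adj_def integral_map_pmf eq by (simp only: exp_sum[OF finite_edges])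
  also have "\<dots> = (\<Prod>ij\<in>?I. measure_pmf.expectation (bernoulli_pmf (p (fst ij) (snd ij))) (\<lambda>b. exp (c ij * of_bool b)))"
    unfolding ER_edges_def
    by (subst expectation_prod_Pi_pmf[OF finite_edges])
       (auto simp: case_prod_unfold intro: integrable_measure_pmf_finite)
  also have "\<dots> \<le> (\<Prod>ij\<in>?I. exp (p (fst ij) (snd ij) * (exp (c ij) - 1)))"
  proof (rule prod_mono)
    fix ij assume ij: "ij \<in> ?I"
    let ?q = "p (fst ij) (snd ij)"
    have q: "0 \<le> ?q" "?q \<le> 1" using ij p_nonneg p_le_1 by auto
    have "measure_pmf.expectation (bernoulli_pmf ?q) (\<lambda>b. exp (c ij * of_bool b)) = 1 + ?q * (exp (c ij) - 1)"
      using q by (simp add: algebra_simps)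
    moreover have "1 + ?q * (exp (c ij) - 1) \<le> exp (?q * (exp (c ij) - 1))"
      by (rule exp_ge_add_one_self)
    ultimately show "0 \<le> measure_pmf.expectation (bernoulli_pmf ?q) (\<lambda>b. exp (c ij * of_bool b)) \<and>
      measure_pmf.expectation (bernoulli_pmf ?q) (\<lambda>b. exp (c ij * of_bool b)) \<le> exp (?q * (exp (c ij) - 1))"
      using Bochner_Integration.integral_nonneg[of "bernoulli_pmf ?q" "\<lambda>b. exp (c ij * of_bool b)"] by simp
  qed
  also have "\<dots> = exp (\<Sum>ij\<in>?I. p (fst ij) (snd ij) * (exp (c ij) - 1))"
    by (simp add: exp_sum finite_edges)
  also have "\<dots> \<le> exp ((\<Sum>i<n. \<Sum>j<n. p i j * (exp (2 * w i j) - 1)) / 2)"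
    unfolding exp_le_cancel_iff sum_square_upper_triangle sum_divide_distrib
  proof (rule sum_mono)
    fix ij assume "ij \<in> ?I"
    then obtain i j where ij: "ij = (i, j)" "i \<le> j" "j < n" by auto
    have q: "p j i = p i j" "0 \<le> p i j" using p_sym p_nonneg ij by auto
    have le: "p i j * (exp (w i j + w j i) - 1) \<le>
        (p i j * (exp (2 * w i j) - 1) + p i j * (exp (2 * w j i) - 1)) / 2"
      using mult_left_mono[OF exp_sum_minus_one_le[of "w i j" "w j i"] q(2)]
      by (simp only: distrib_left times_divide_eq_right add_divide_distrib)
    have le': "p i j * (exp (w i j) - 1) \<le> p i j * (exp (2 * w i j) - 1) / 2"
      using mult_left_mono[OF exp_minus_one_le[of "w i j"] q(2)]
      by (simp only: times_divide_eq_right)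
    show "p (fst ij) (snd ij) * (exp (c ij) - 1) \<le> 
      (case ij of (i, j) \<Rightarrow> if i = j then p i i * (exp (2 * w i i) - 1)
         else p i j * (exp (2 * w i j) - 1) + p j i * (exp (2 * w j i) - 1)) / 2"
    proof (cases "i = j")
      case True
      then show ?thesis using le' by (simp only: c_def ij(1) prod.case fst_conv snd_conv if_True simp_thms)
    next
      case False
      then show ?thesis using le
        by (simp only: c_def ij(1) q(1) prod.case fst_conv snd_conv if_False simp_thms)
    qed
  qed
  finally show ?thesis .
qed

text \<open>Centering replaces \<open>exp (2 w) - 1\<close> by \<open>exp (2 w) - 1 - 2 w\<close>,
  which is at most \<open>4 w^2\<close> when \<open>\<bar>2 w\<bar> \<le> 1\<close>. This is the
  Bernstein regime, where only the variance enters.\<close>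

lemma centered_mgf_le:
  assumes "\<And>i j. i < n \<Longrightarrow> j < n \<Longrightarrow> \<bar>w i j\<bar> \<le> 1/2"
  shows "measure_pmf.expectation (ER_adj n p) (\<lambda>A. exp (\<Sum>i<n. \<Sum>j<n. w i j * (A i j - p i j)))
     \<le> exp (2 * (\<Sum>i<n. \<Sum>j<n. p i j * (w i j)\<^sup>2))"
proof -
  let ?s = "\<Sum>i<n. \<Sum>j<n. w i j * p i j"
  have "measure_pmf.expectation (ER_adj n p) (\<lambda>A. exp (\<Sum>i<n. \<Sum>j<n. w i j * (A i j - p i j)))
    = measure_pmf.expectation (ER_adj n p) (\<lambda>A. exp (-?s) * exp (\<Sum>i<n. \<Sum>j<n. w i j * A i j))"
    by (simp add: algebra_simps sum_subtractf flip: exp_add)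
  also have "\<dots> = exp (-?s) * measure_pmf.expectation (ER_adj n p) (\<lambda>A. exp (\<Sum>i<n. \<Sum>j<n. w i j * A i j))"
    by simp
  also have "\<dots> \<le> exp (-?s) * exp ((\<Sum>i<n. \<Sum>j<n. p i j * (exp (2 * w i j) - 1)) / 2)"
    by (intro mult_left_mono mgf_le) auto
  also have "\<dots> = exp (\<Sum>i<n. \<Sum>j<n. p i j * (exp (2 * w i j) - 1 - 2 * w i j) / 2)"
    by (simp add: algebra_simps sum_subtractf sum.distrib sum_divide_distrib diff_divide_distrib add_divide_distrib flip: exp_add)
  also have "\<dots> \<le> exp (\<Sum>i<n. \<Sum>j<n. 2 * (p i j * (w i j)\<^sup>2))"
    unfolding exp_le_cancel_iff
  proof (intro sum_mono)
    fix i j assume ij: "i \<in> {..<n}" "j \<in> {..<n}"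
    have "exp (2 * w i j) - 1 - 2 * w i j \<le> 4 * (w i j)\<^sup>2"
      using exp_le_quadratic[of "2 * w i j"] assms[of i j] ij by (auto simp: power_mult_distrib abs_mult)
    then have "p i j * (exp (2 * w i j) - 1 - 2 * w i j) \<le> p i j * (4 * (w i j)\<^sup>2)"
      using p_nonneg ij by (intro mult_left_mono) auto
    then show "p i j * (exp (2 * w i j) - 1 - 2 * w i j) / 2 \<le> 2 * (p i j * (w i j)\<^sup>2)" by simp
  qed
  finally show ?thesis by (simp add: sum_distrib_left)
qed

lemma prob_Markov:
  assumes "\<And>A. A \<in> set_pmf (ER_adj n p) \<Longrightarrow> 0 \<le> f A" "0 < a"
  shows "measure_pmf.prob (ER_adj n p) {A. a \<le> f A} \<le> measure_pmf.expectation (ER_adj n p) f / a"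
proof -
  have "measure_pmf.prob (ER_adj n p) {A \<in> space (measure_pmf (ER_adj n p)). a \<le> f A}
      \<le> measure_pmf.expectation (ER_adj n p) f / a"
    by (rule integral_Markov_inequality_measure[where A = "{}"])
       (use assms in \<open>simp_all add: AE_measure_pmf_iff\<close>)
  then show ?thesis by simp
qed

lemma prob_Chernoff:
  assumes "measure_pmf.expectation (ER_adj n p) (\<lambda>A. exp (f A)) \<le> exp b"
  shows "measure_pmf.prob (ER_adj n p) {A. a \<le> f A} \<le> exp (b - a)"
proof -
  have "measure_pmf.prob (ER_adj n p) {A. exp a \<le> exp (f A)} \<le> 
    measure_pmf.expectation (ER_adj n p) (\<lambda>A. exp (f A)) / exp a"
    by (rule prob_Markov) auto
  also have "\<dots> \<le> exp b / exp a" using assms by (intro divide_right_mono) auto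
  finally show ?thesis by (simp add: exp_diff)
qed

end

section \<open>Heavy pairs\<close>

text \<open>This is \<open>s * ln (e n / s)\<close>, the standard upper bound for the logarithm of
  the number of \<open>s\<close>-element subsets of an \<open>n\<close>-element set.\<close>

definition entropy :: "nat \<Rightarrow> nat \<Rightarrow> real" where
  "entropy n s = real s * (1 + ln (real n / real s))"

text \<open>Apply \<open>ln t \<le> t - 1\<close> to \<open>t = n * exp (- c) / s\<close>. The free
  parameter \<open>c\<close> trades the size of the set against an exponentially small multiple of
  \<open>n\<close>.\<close>

lemma entropy_le:
  assumes "0 < s" "0 < n"
  shows "entropy n s \<le> c * real s + real n * exp (- c)"
proof -
  have "ln (real n * exp (- c) / real s) \<le> real n * exp (- c) / real s - 1"
    using assms by (intro ln_le_minus_one) auto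
  then have "real s * ln (real n * exp (- c) / real s) \<le> real s * (real n * exp (- c) / real s - 1)"
    by (rule mult_left_mono) simp
  also have "ln (real n * exp (- c) / real s) = ln (real n / real s) - c"
    using assms by (simp add: ln_div ln_mult)
  finally show ?thesis using assms by (simp add: entropy_def algebra_simps)
qed

section \<open>Geometric sums over dyadic levels\<close>

lemma sum_Suc_over_power2: "(\<Sum>q\<le>N. (1 + real q) / 2 ^ q) \<le> 4"
proof -
  have "(\<Sum>q\<le>N. (1 + real q) / 2 ^ q) = 4 - (real N + 3) / 2 ^ N"
    by (induction N) (auto simp: field_simps)
  then show ?thesis by (smt (verit) divide_nonneg_nonneg of_nat_0_le_iff zero_le_power)
qed

lemma sum_inverse_power2: "(\<Sum>q\<le>N. 1 / 2 ^ q :: real) \<le> 2"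
proof -
  have "(\<Sum>q\<le>N. 1 / 2 ^ q :: real) = 2 - 1 / 2 ^ N"
    by (induction N) (auto simp: field_simps)
  then show ?thesis by simp
qed

lemma ex_dyadic_level: "\<exists>k. 2 ^ k \<le> \<bar>real_of_int a\<bar> \<and> \<bar>real_of_int a\<bar> < 2 ^ (k + 1)" if "a \<noteq> 0"
proof -
  have "1 \<le> nat \<bar>a\<bar>" using that by simp
  from ex_power_ivl1[OF _ this, of 2] obtain k where "2 ^ k \<le> nat \<bar>a\<bar>" "nat \<bar>a\<bar> < 2 ^ (k + 1)"
    by auto
  then have "real (2 ^ k) \<le> real (nat \<bar>a\<bar>)" "real (nat \<bar>a\<bar>) < real (2 ^ (k + 1))"
    by (simp_all only: of_nat_le_iff of_nat_less_iff)
  then show ?thesis by (intro exI[of _ k]) auto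
qed

text \<open>In the variable \<open>q = k + M - l\<close> the inner sum consists of the two series
  bounded by 4 and 2, which gives \<open>12 * \<alpha> k + 2 / 2 ^ k\<close>. Summing over
  \<open>k\<close> yields \<open>12 * 4 + 2 * 2 = 52\<close>.\<close>

lemma dyadic_weight_sum_le:
  fixes \<alpha> :: "nat \<Rightarrow> real"
  assumes \<alpha>: "\<And>k. 0 \<le> \<alpha> k" "(\<Sum>k\<le>N. \<alpha> k) \<le> 4"
  shows "(\<Sum>k\<le>N. \<Sum>l\<in>{l. l \<le> k + M}.
     (3 * (1 + real (k + M - l)) * \<alpha> k + 1 / 2 ^ k) / 2 ^ (k + M - l)) \<le> 52"
proof -
  have "(\<Sum>l\<in>{l. l \<le> k + M}. (3 * (1 + real (k + M - l)) * \<alpha> k + 1 / 2 ^ k) / 2 ^ (k + M - l))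
      \<le> 12 * \<alpha> k + 2 * (1 / 2 ^ k)" for k
  proof -
    have "(\<Sum>l\<in>{l. l \<le> k + M}. (3 * (1 + real (k + M - l)) * \<alpha> k + 1 / 2 ^ k) / 2 ^ (k + M - l))
       = (\<Sum>q\<le>k + M. (3 * (1 + real q) * \<alpha> k + 1 / 2 ^ k) / 2 ^ q)"
      by (rule sum.reindex_bij_witness[of _ "\<lambda>q. k + M - q" "\<lambda>l. k + M - l"]) auto
    also have "\<dots> = 3 * \<alpha> k * (\<Sum>q\<le>k + M. (1 + real q) / 2 ^ q) + (1 / 2 ^ k) * (\<Sum>q\<le>k + M. 1 / 2 ^ q)"
      by (simp add: sum_distrib_left sum.distrib[symmetric] add_divide_distrib algebra_simps)
    also have "\<dots> \<le> 3 * \<alpha> k * 4 + (1 / 2 ^ k) * 2"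
      using \<alpha>(1) by (intro add_mono mult_left_mono sum_Suc_over_power2 sum_inverse_power2) auto
    finally show ?thesis by simp
  qed
  then have "(\<Sum>k\<le>N. \<Sum>l\<in>{l. l \<le> k + M}.
     (3 * (1 + real (k + M - l)) * \<alpha> k + 1 / 2 ^ k) / 2 ^ (k + M - l)) \<le> (\<Sum>k\<le>N. 12 * \<alpha> k + 2 * (1 / 2 ^ k))"
    by (rule sum_mono)
  also have "\<dots> = 12 * (\<Sum>k\<le>N. \<alpha> k) + 2 * (\<Sum>k\<le>N. 1 / 2 ^ k)"
    by (simp add: sum.distrib sum_distrib_left)
  also have "\<dots> \<le> 12 * 4 + 2 * 2"
    using \<alpha>(2) by (intro add_mono mult_left_mono sum_inverse_power2) auto
  finally show ?thesis by simp
qed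

definition edge_weight :: "(nat \<Rightarrow> nat \<Rightarrow> real) \<Rightarrow> nat set \<Rightarrow> nat set \<Rightarrow> real" where
  "edge_weight A S T = (\<Sum>i\<in>S. \<Sum>j\<in>T. A i j)"

text \<open>The number \<open>m\<close> is the exponential tilt of a Chernoff bound for the edges
  between \<open>S\<close> and \<open>T\<close>. It is left free so that each pair of levels can
  choose its own. The range up to \<open>4 * n\<close> suffices because levels are at most
  \<open>n\<close> and the tilts used are at most \<open>2 * n + 2\<close>.\<close>

definition discrepancy :: "nat \<Rightarrow> real \<Rightarrow> real \<Rightarrow> (nat \<Rightarrow> nat \<Rightarrow> real) \<Rightarrow> bool" where
  "discrepancy n d r A \<longleftrightarrow> (\<forall>S T m. S \<subseteq> {..<n} \<longrightarrow> T \<subseteq> {..<n} \<longrightarrow> S \<noteq> {} \<longrightarrow> T \<noteq> {} \<longrightarrow> m \<in> {1..4 * n} \<longrightarrow>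
     real m * edge_weight A S T \<le> 3 / 2 * (d * real (card S) * real (card T) / real n) * 2 ^ m
        + 12 * r * (entropy n (card S) + entropy n (card T)))"

text \<open>The entropy of a level set, multiplied by the weight of the pair and divided by the tilt
  \<open>m = k + l + 2 - L\<close>, decays geometrically in \<open>k + L + 1 - l\<close>.\<close>

lemma level_entropy_le:
  fixes \<alpha> :: real
  assumes "0 < s" "0 < n" and s: "4 ^ k * real s \<le> real n * \<alpha>"
    and l: "l \<le> k + L + 1" and L: "L \<le> k + l + 1" and m: "m = k + l + 2 - L"
  shows "2 ^ (k + l) * entropy n s / real m \<le>
    real n * 2 ^ (L + 1) * ((3 * (1 + real (k + (L + 1) - l)) * \<alpha> + 1 / 2 ^ k) / 2 ^ (k + (L + 1) - l))"
proof -
  define q where "q = k + (L + 1) - l"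
  have lq: "l + q = k + L + 1" using l by (simp add: q_def)
  have m1: "1 \<le> m" "m + q = 2 * k + 3" using m L l by (auto simp: q_def)
  have \<alpha>: "0 \<le> \<alpha>" using s assms(1,2) 
    by (smt (verit) mult_nonneg_nonneg of_nat_0_le_iff zero_le_power zero_less_mult_iff of_nat_0_less_iff mult_pos_pos zero_less_power)
  \<comment> \<open>With \<open>c = 3 * k\<close> in the entropy bound the remainder is at most
    \<open>n / 8 ^ k\<close>, so it stays summable in \<open>k\<close> after multiplication by
    \<open>4 ^ k\<close>.\<close>
  have "exp (- (3 * real k)) \<le> 1 / 8 ^ k"
  proof -
    have "(2::real) ^ (3 * k) \<le> exp 1 ^ (3 * k)"
      using exp_ge_add_one_self[of 1] by (intro power_mono) auto
    also have "\<dots> = exp (3 * real k)" by (simp flip: exp_of_nat_mult)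
    finally have "8 ^ k \<le> exp (3 * real k)" by (simp add: power_mult)
    then show ?thesis by (simp add: exp_minus field_simps)
  qed
  then have "entropy n s \<le> 3 * real k * real s + real n * (1 / 8 ^ k)"
    using entropy_le[of s n "3 * real k"] assms(1,2)
    by (smt (verit) mult_left_mono of_nat_0_le_iff)
  then have "4 ^ k * entropy n s \<le> 4 ^ k * (3 * real k * real s + real n * (1 / 8 ^ k))"
    by simp
  also have "\<dots> = 3 * real k * (4 ^ k * real s) + real n * (1 / 2 ^ k)"
    by (simp add: field_simps flip: power_mult_distrib)
  also have "\<dots> \<le> 3 * real k * (real n * \<alpha>) + real n * (1 / 2 ^ k)"
    using s by (intro add_mono mult_left_mono) auto
  finally have "4 ^ k * entropy n s \<le> real n * (3 * real k * \<alpha> + 1 / 2 ^ k)"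
    by (simp add: algebra_simps)
  then have "4 ^ k * entropy n s / real m \<le> real n * (3 * real k * \<alpha> + 1 / 2 ^ k) / real m"
    by (rule divide_right_mono) simp
  also have "\<dots> = real n * (3 * (real k / real m) * \<alpha> + 1 / 2 ^ k / real m)"
    by (simp add: add_divide_distrib algebra_simps)
  also have "\<dots> \<le> real n * (3 * (1 + real q) * \<alpha> + 1 / 2 ^ k)"
  proof (intro mult_left_mono add_mono mult_right_mono)
    \<comment> \<open>Since \<open>m + q = 2 * k + 3\<close>, either \<open>q \<ge> k\<close> or
      \<open>m > k\<close>. Hence \<open>k / m\<close> costs only a factor \<open>1 + q\<close>,
      which the decay \<open>1 / 2 ^ q\<close> absorbs.\<close>
    have "k \<le> m + m * q" 
    proof (cases "q \<ge> k")
      case True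
      then show ?thesis using m1 by (metis add_increasing le_add2 le_trans mult_le_mono1 mult_1 zero_le)
    qed (use m1 in auto)
    then have "real k \<le> (1 + real q) * real m" 
      by (metis add.commute mult.commute of_nat_Suc of_nat_le_iff of_nat_mult mult_Suc_right)
    then show "real k / real m \<le> 1 + real q" using m1 by (simp add: divide_le_eq)
    show "1 / 2 ^ k / real m \<le> 1 / 2 ^ k" using m1 by (simp add: divide_le_eq)
  qed (use \<alpha> in auto)
  finally have *: "4 ^ k * entropy n s / real m \<le> real n * (3 * (1 + real q) * \<alpha> + 1 / 2 ^ k)" .
  have pw: "2 ^ (k + l) = (4::real) ^ k * (2 ^ (L + 1) / 2 ^ q)"
  proof -
    have "2 ^ (k + l) * 2 ^ q = (2::real) ^ (k + (l + q))" by (simp add: power_add)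
    also have "k + (l + q) = 2 * k + (L + 1)" using lq by simp
    also have "(2::real) ^ (2 * k + (L + 1)) = 2 ^ (2 * k) * 2 ^ (L + 1)" by (rule power_add)
    also have "(2::real) ^ (2 * k) = 4 ^ k" by (simp add: power_mult)
    finally show ?thesis by (simp add: field_simps)
  qed
  have "2 ^ (k + l) * entropy n s / real m = (2 ^ (L + 1) / 2 ^ q) * (4 ^ k * entropy n s / real m)"
    unfolding pw by (simp add: field_simps)
  also have "\<dots> \<le> (2 ^ (L + 1) / 2 ^ q) * (real n * (3 * (1 + real q) * \<alpha> + 1 / 2 ^ k))"
    using * by (rule mult_left_mono) simp
  also have "\<dots> = real n * 2 ^ (L + 1) * ((3 * (1 + real q) * \<alpha> + 1 / 2 ^ k) / 2 ^ q)"
    by simp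
  finally show ?thesis unfolding q_def .
qed

text \<open>The tilt \<open>m = k + l + 2 - L\<close> satisfies
  \<open>2 ^ m * 2 ^ L = 2 ^ (k + l + 2)\<close>, so with \<open>d \<le> 2 ^ L * \<sigma>\<close>
  the mean term becomes \<open>16 * 4 ^ k * 4 ^ l * card S * card T\<close>, up to the factor
  \<open>3 / 2 * \<sigma> / n\<close>, and hence a multiple of \<open>\<alpha> * \<beta>\<close>.
  The entropies of the two sets are treated separately by \<open>level_entropy_le\<close>.\<close>

lemma heavy_level_pair_le:
  fixes \<alpha> \<beta> :: real
  assumes disc: "discrepancy n d r A" and n: "0 < n" and r: "0 \<le> r" and d: "0 \<le> d"
    and S: "S \<subseteq> {..<n}" "4 ^ k * real (card S) \<le> real n * \<alpha>"
    and T: "T \<subseteq> {..<n}" "4 ^ l * real (card T) \<le> real n * \<beta>"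
    and ab: "0 \<le> \<alpha>" "0 \<le> \<beta>"
    and kl: "k \<le> n" "l \<le> n" "l \<le> k + L + 1" "k \<le> l + L + 1" "L \<le> k + l + 1"
    and dL: "d \<le> 2 ^ L * \<sigma>"
  shows "2 ^ (k + l + 2) * edge_weight A S T \<le> 24 * real n * \<sigma> * (\<alpha> * \<beta>)
    + 48 * r * (real n * 2 ^ (L + 1)) *
       ((3 * (1 + real (k + (L + 1) - l)) * \<alpha> + 1 / 2 ^ k) / 2 ^ (k + (L + 1) - l)
      + (3 * (1 + real (l + (L + 1) - k)) * \<beta> + 1 / 2 ^ l) / 2 ^ (l + (L + 1) - k))"
    (is "_ \<le> ?M + 48 * r * ?c * (?F + ?G)")
proof (cases "S = {} \<or> T = {}")
  case True
  have "0 \<le> \<sigma>" using d dL by (smt (verit) zero_less_power zero_le_mult_iff)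
  then have "0 \<le> ?M" using ab by (intro mult_nonneg_nonneg) auto
  moreover have "0 \<le> ?F" "0 \<le> ?G" using ab by auto
  ultimately show ?thesis using True r by (auto simp: edge_weight_def)
next
  case False
  define m where "m = k + l + 2 - L"
  define s where "s = card S"
  define t where "t = card T"
  have st: "0 < s" "0 < t" using False S T by (auto simp: s_def t_def card_gt_0_iff intro: finite_subset)
  \<comment> \<open>The condition \<open>L \<le> k + l + 1\<close> makes the natural subtraction
    exact and the tilt at least 1, so division by it is harmless.\<close>
  have m: "m \<in> {1..4 * n}" "m + L = k + l + 2" using kl n by (auto simp: m_def)
  have m': "m = l + k + 2 - L" by (simp add: m_def)
  have "real m * edge_weight A S T \<le> 3 / 2 * (d * real s * real t / real n) * 2 ^ m
        + 12 * r * (entropy n s + entropy n t)"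
    using disc S(1) T(1) False m(1) unfolding discrepancy_def s_def t_def by blast
  then have "edge_weight A S T \<le> (3 / 2 * (d * real s * real t / real n) * 2 ^ m
        + 12 * r * (entropy n s + entropy n t)) / real m"
    using m(1) by (simp add: pos_le_divide_eq mult.commute)
  then have "2 ^ (k + l + 2) * edge_weight A S T \<le> 2 ^ (k + l + 2) * ((3 / 2 * (d * real s * real t / real n) * 2 ^ m
        + 12 * r * (entropy n s + entropy n t)) / real m)"
    by (rule mult_left_mono) simp
  also have "\<dots> = 3 / 2 * (2 ^ (k + l + 2) * 2 ^ m * (d * real s * real t / real n)) / real m
     + 48 * r * (2 ^ (k + l) * entropy n s / real m + 2 ^ (l + k) * entropy n t / real m)"
    by (simp add: add_divide_distrib algebra_simps power_add)
  also have "\<dots> \<le> ?M + 48 * r * (?c * ?F + ?c * ?G)"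
  proof (intro add_mono mult_left_mono)
    have "3 / 2 * (2 ^ (k + l + 2) * 2 ^ m * (d * real s * real t / real n)) / real m
        \<le> 3 / 2 * (2 ^ (k + l + 2) * 2 ^ m * (d * real s * real t / real n)) / 1"
      using m(1) d by (intro divide_left_mono) (auto intro!: mult_nonneg_nonneg)
    also have "\<dots> \<le> 3 / 2 * (2 ^ (k + l + 2) * 2 ^ m * ((2 ^ L * \<sigma>) * real s * real t / real n)) / 1"
      using dL by (intro divide_right_mono mult_left_mono mult_right_mono) auto
    also have "\<dots> = 3 / 2 * \<sigma> / real n * (2 ^ (k + l + 2) * 2 ^ (m + L)) * (real s * real t)"
      by (simp add: power_add field_simps)
    also have "2 ^ (k + l + 2) * 2 ^ (m + L) = (16::real) * (4 ^ k * 4 ^ l)"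
    proof -
      have "(4::real) ^ u = 2 ^ u * 2 ^ u" for u by (simp flip: power_mult_distrib)
      then show ?thesis unfolding m(2) by (simp add: power_add)
    qed
    also have "3 / 2 * \<sigma> / real n * (16 * (4 ^ k * 4 ^ l)) * (real s * real t)
       = 24 * \<sigma> / real n * ((4 ^ k * real s) * (4 ^ l * real t))" by simp
    also have "\<dots> \<le> 24 * \<sigma> / real n * ((real n * \<alpha>) * (real n * \<beta>))"
    proof -
      have "0 \<le> \<sigma>" using d dL by (smt (verit) zero_less_power zero_le_mult_iff)
      moreover have "(4 ^ k * real s) * (4 ^ l * real t) \<le> (real n * \<alpha>) * (real n * \<beta>)"
        by (rule mult_mono) (use S T ab in \<open>auto simp: s_def t_def\<close>)
      ultimately show ?thesis by (intro mult_left_mono) auto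
    qed
    also have "\<dots> = ?M" using n by (simp add: field_simps)
    finally show "3 / 2 * (2 ^ (k + l + 2) * 2 ^ m * (d * real s * real t / real n)) / real m \<le> ?M" .
    show "2 ^ (k + l) * entropy n s / real m \<le> ?c * ?F"
      by (rule level_entropy_le) (use st n S kl m_def in \<open>auto simp: s_def\<close>)
    show "2 ^ (l + k) * entropy n t / real m \<le> ?c * ?G"
      by (rule level_entropy_le) (use st n T kl m' in \<open>auto simp: t_def\<close>)
  qed (use r in auto)
  finally show ?thesis by (simp add: algebra_simps)
qed

text \<open>Pairs of very different size are charged to the weighted degrees and cost
  \<open>56 + 56\<close>. The others lie in level pairs from \<open>R\<close>: the products
  \<open>\<alpha> k * \<beta> l\<close> contribute \<open>48 * 16 = 768\<close> and the entropies
  \<open>96 * 104 * r = 9984 * r\<close>, all in units of \<open>sqrt d * n\<close>. As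
  \<open>r \<ge> 1\<close>, the total is below \<open>11000 * r\<close>.\<close>

lemma heavy_sum_le:
  fixes X Y :: "nat \<Rightarrow> int"
  assumes disc: "discrepancy n d r A" and n: "0 < n" and r: "1 \<le> r" and d: "1 \<le> d"
    and A: "\<And>i j. i < n \<Longrightarrow> j < n \<Longrightarrow> 0 \<le> A i j"
    and X: "(\<Sum>i<n. (real_of_int (X i))\<^sup>2) \<le> 4 * real n"
    and Y: "(\<Sum>i<n. (real_of_int (Y i))\<^sup>2) \<le> 4 * real n"
    and dX: "(\<Sum>i<n. \<Sum>j<n. A i j * (real_of_int (X i))\<^sup>2) \<le> 56 * d * real n"
    and dY: "(\<Sum>i<n. \<Sum>j<n. A i j * (real_of_int (Y j))\<^sup>2) \<le> 56 * d * real n"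
  shows "(\<Sum>i<n. \<Sum>j<n. if sqrt d < \<bar>real_of_int (X i * Y j)\<bar> then A i j * \<bar>real_of_int (X i * Y j)\<bar> else 0)
     \<le> 11000 * r * sqrt d * real n"
proof -
  obtain lev :: "int \<Rightarrow> nat" where 
    lev: "\<And>a. a \<noteq> 0 \<Longrightarrow> 2 ^ lev a \<le> \<bar>real_of_int a\<bar> \<and> \<bar>real_of_int a\<bar> < 2 ^ (lev a + 1)"
    using ex_dyadic_level by metis
  obtain L :: nat where L: "2 ^ L \<le> sqrt d" "sqrt d < 2 ^ (L + 1)"
  proof -
    have f: "1 \<le> \<lfloor>sqrt d\<rfloor>" using d by (simp add: le_floor_iff)
    obtain L where L: "2 ^ L \<le> \<bar>real_of_int \<lfloor>sqrt d\<rfloor>\<bar>" "\<bar>real_of_int \<lfloor>sqrt d\<rfloor>\<bar> < 2 ^ (L + 1)"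
      using ex_dyadic_level[of "\<lfloor>sqrt d\<rfloor>"] f by auto
    have "\<lfloor>sqrt d\<rfloor> < 2 ^ (L + 1)"
      using L(2) f by (metis abs_of_pos int_one_le_iff_zero_less of_int_abs of_int_less_numeral_power_cancel_iff)
    then have "sqrt d < 2 ^ (L + 1)" by (simp add: floor_less_iff)
    moreover have "2 ^ L \<le> sqrt d" using L(1) f by linarith
    ultimately show ?thesis using that by blast
  qed
  define S where "S k = {i. i < n \<and> X i \<noteq> 0 \<and> lev (X i) = k}" for k
  define T where "T k = {i. i < n \<and> Y i \<noteq> 0 \<and> lev (Y i) = k}" for k
  define \<alpha> where "\<alpha> k = (\<Sum>i\<in>S k. (real_of_int (X i))\<^sup>2) / real n" for k
  define \<beta> where "\<beta> k = (\<Sum>i\<in>T k. (real_of_int (Y i))\<^sup>2) / real n" for k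
  \<comment> \<open>The first two conditions relating \<open>k\<close>, \<open>l\<close> and
    \<open>L\<close> are the dyadic form of a ratio between \<open>1 / sqrt d\<close> and
    \<open>sqrt d\<close>, the last that of \<open>\<bar>X i * Y j\<bar> > sqrt d\<close>. The added
    ones come from the strict upper ends of the dyadic intervals.\<close>
  define R where "R = {(k, l). k \<le> n \<and> l \<le> n \<and> l \<le> k + L + 1 \<and> k \<le> l + L + 1 \<and> L \<le> k + l + 1}"
  have finR: "finite R" by (rule finite_subset[of _ "{..n} \<times> {..n}"]) (auto simp: R_def)

  have level_sum: "(\<Sum>k\<le>n. (\<Sum>i\<in>{i. i < n \<and> Z i \<noteq> 0 \<and> lev (Z i) = k}. (real_of_int (Z i))\<^sup>2) / real n) \<le> 4"
    if "(\<Sum>i<n. (real_of_int (Z i))\<^sup>2) \<le> 4 * real n" for Z :: "nat \<Rightarrow> int"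
  proof -
    have "(\<Sum>k\<le>n. (\<Sum>i\<in>{i. i < n \<and> Z i \<noteq> 0 \<and> lev (Z i) = k}. (real_of_int (Z i))\<^sup>2))
       = (\<Sum>k\<in>{..n}. (\<Sum>i\<in>{i \<in> {i. i < n \<and> Z i \<noteq> 0 \<and> lev (Z i) \<le> n}. lev (Z i) = k}. (real_of_int (Z i))\<^sup>2))"
      by (intro sum.cong) auto
    also have "\<dots> = (\<Sum>i\<in>{i. i < n \<and> Z i \<noteq> 0 \<and> lev (Z i) \<le> n}. (real_of_int (Z i))\<^sup>2)"
      by (intro sum.group) auto
    also have "\<dots> \<le> (\<Sum>i<n. (real_of_int (Z i))\<^sup>2)" by (intro sum_mono2) auto
    also have "\<dots> \<le> 4 * real n" by (rule that)
    finally show ?thesis using n by (simp add: divide_le_eq flip: sum_divide_distrib)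
  qed
  have level_card: "4 ^ k * real (card {i. i < n \<and> Z i \<noteq> 0 \<and> lev (Z i) = k})
     \<le> real n * ((\<Sum>i\<in>{i. i < n \<and> Z i \<noteq> 0 \<and> lev (Z i) = k}. (real_of_int (Z i))\<^sup>2) / real n)" for Z :: "nat \<Rightarrow> int" and k
  proof -
    let ?S = "{i. i < n \<and> Z i \<noteq> 0 \<and> lev (Z i) = k}"
    have "4 ^ k * real (card ?S) = (\<Sum>i\<in>?S. 4 ^ k)" by simp
    also have "\<dots> \<le> (\<Sum>i\<in>?S. (real_of_int (Z i))\<^sup>2)"
    proof (rule sum_mono)
      fix i assume "i \<in> ?S"
      then have "(2 ^ k)\<^sup>2 \<le> \<bar>real_of_int (Z i)\<bar>\<^sup>2" using lev[of "Z i"] by (intro power_mono) auto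
      moreover have "((2::real) ^ k)\<^sup>2 = 4 ^ k" by (simp add: power2_eq_square flip: power_mult_distrib)
      ultimately show "4 ^ k \<le> (real_of_int (Z i))\<^sup>2" by simp
    qed
    finally show ?thesis using n by simp
  qed
  \<comment> \<open>A level above \<open>n\<close> would give
    \<open>4 ^ (n + 1) \<le> (Z i)^2 \<le> 4 * n\<close>, contradicting
    \<open>n < 4 ^ n\<close>.\<close>
  have level_le_n: "lev (Z i) \<le> n" if "i < n" "Z i \<noteq> 0" "(\<Sum>i<n. (real_of_int (Z i))\<^sup>2) \<le> 4 * real n"
    for Z :: "nat \<Rightarrow> int" and i
  proof (rule ccontr)
    assume "\<not> lev (Z i) \<le> n"
    then have "(4::real) ^ (n + 1) \<le> 4 ^ lev (Z i)" by (intro power_increasing) auto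
    also have "\<dots> = (2 ^ lev (Z i))\<^sup>2" by (simp add: power2_eq_square flip: power_mult_distrib)
    also have "\<dots> \<le> \<bar>real_of_int (Z i)\<bar>\<^sup>2" using lev[of "Z i"] that by (intro power_mono) auto
    also have "\<dots> = (real_of_int (Z i))\<^sup>2" by simp
    also have "\<dots> \<le> (\<Sum>i<n. (real_of_int (Z i))\<^sup>2)"
      using that by (intro member_le_sum) auto
    also have "\<dots> \<le> 4 * real n" by (rule that)
    finally have "(4::real) ^ n \<le> real n" by simp
    moreover have "real n < 2 ^ n" by (rule of_nat_less_two_power)
    moreover have "(2::real) ^ n \<le> 4 ^ n" by (intro power_mono) auto
    ultimately show False by linarith
  qed
  have \<alpha>4: "(\<Sum>k\<le>n. \<alpha> k) \<le> 4" unfolding \<alpha>_def S_def by (rule level_sum[OF X])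
  have \<beta>4: "(\<Sum>k\<le>n. \<beta> k) \<le> 4" unfolding \<beta>_def T_def by (rule level_sum[OF Y])
  have \<alpha>0: "0 \<le> \<alpha> k" and \<beta>0: "0 \<le> \<beta> k" for k by (auto simp: \<alpha>_def \<beta>_def intro!: divide_nonneg_nonneg sum_nonneg)

  define P where "P = {(i, j). i < n \<and> j < n \<and> X i \<noteq> 0 \<and> Y j \<noteq> 0 \<and> (lev (X i), lev (Y j)) \<in> R}"
  \<comment> \<open>Both factors are replaced by the upper ends of their dyadic intervals, so the
    weight depends on the levels only and the sum over a level pair is a multiple of an edge
    count.\<close>
  define h where "h = (\<lambda>(i, j). 2 ^ (lev (X i) + lev (Y j) + 2) * A i j)"
  have P_sub: "P \<subseteq> {..<n} \<times> {..<n}" by (auto simp: P_def)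
  then have finP: "finite P" by (rule finite_subset) auto
  have h0: "0 \<le> h ij" if "ij \<in> {..<n} \<times> {..<n}" for ij using that A by (auto simp: h_def)

  \<comment> \<open>Pairs with \<open>|X i| / |Y j|\<close> outside \<open>[1 / sqrt d, sqrt d]\<close> are paid for by the degrees.\<close>
  have ptw: "(if sqrt d < \<bar>real_of_int (X i * Y j)\<bar> then A i j * \<bar>real_of_int (X i * Y j)\<bar> else 0)
     \<le> A i j * (real_of_int (X i))\<^sup>2 / sqrt d + A i j * (real_of_int (Y j))\<^sup>2 / sqrt d
        + (if (i, j) \<in> P then h (i, j) else 0)" if ij: "i < n" "j < n" for i j
  proof -
    define x where "x = \<bar>real_of_int (X i)\<bar>"
    define y where "y = \<bar>real_of_int (Y j)\<bar>"
    have sd: "0 < sqrt d" using d by simp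
    have xy: "0 \<le> x" "0 \<le> y" "\<bar>real_of_int (X i * Y j)\<bar> = x * y"
      "(real_of_int (X i))\<^sup>2 = x\<^sup>2" "(real_of_int (Y j))\<^sup>2 = y\<^sup>2"
      by (auto simp: x_def y_def abs_mult)
    have a: "0 \<le> A i j" using A ij by simp
    have nn: "0 \<le> A i j * x\<^sup>2 / sqrt d" "0 \<le> A i j * y\<^sup>2 / sqrt d" "0 \<le> (if (i, j) \<in> P then h (i, j) else 0)"
      using a sd h0[of "(i,j)"] ij by auto
    consider "x * y \<le> sqrt d" | "sqrt d * y \<le> x" | "sqrt d * x \<le> y"
      | "sqrt d < x * y" "x < sqrt d * y" "y < sqrt d * x" by linarith
    then show ?thesis
    proof cases
      case 1 then show ?thesis using nn unfolding xy by auto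
    next
      case 2
      then have "y \<le> x / sqrt d" using sd by (simp add: pos_le_divide_eq mult.commute)
      then have "x * y \<le> x * (x / sqrt d)" using xy by (intro mult_left_mono) auto
      then have "A i j * (x * y) \<le> A i j * (x\<^sup>2 / sqrt d)" using a by (intro mult_left_mono) (auto simp: power2_eq_square)
      then show ?thesis using nn unfolding xy by (auto split: if_splits)
    next
      case 3
      then have "x \<le> y / sqrt d" using sd by (simp add: pos_le_divide_eq mult.commute)
      then have "x * y \<le> y / sqrt d * y" using xy by (intro mult_right_mono) auto
      then have "A i j * (x * y) \<le> A i j * (y\<^sup>2 / sqrt d)" using a by (intro mult_left_mono) (auto simp: power2_eq_square)
      then show ?thesis using nn unfolding xy by (auto split: if_splits)
    next
      case 4
      have "x \<noteq> 0" "y \<noteq> 0" using 4 sd by auto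
      then have nz: "X i \<noteq> 0" "Y j \<noteq> 0" by (auto simp: x_def y_def)
      let ?k = "lev (X i)" and ?l = "lev (Y j)"
      have k: "2 ^ ?k \<le> x" "x < 2 ^ (?k + 1)" and l: "2 ^ ?l \<le> y" "y < 2 ^ (?l + 1)"
        using lev nz by (auto simp: x_def y_def)
      have xyle: "x * y \<le> 2 ^ (?k + 1) * 2 ^ (?l + 1)"
        using k l xy by (intro mult_mono) auto
      have "(2::real) ^ L < 2 ^ (?k + 1) * 2 ^ (?l + 1)" using xyle 4(1) L(1) by linarith
      then have "(2::real) ^ L < 2 ^ (?k + ?l + 2)" by (simp add: power_add)
      then have "L < ?k + ?l + 2" by (rule power_less_imp_less_exp[rotated]) simp
      then have r1: "L \<le> ?k + ?l + 1" by simp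
      have aux: "u \<le> v + L + 1" if "2 ^ u \<le> x'" "x' < sqrt d * y'" "y' < 2 ^ (v + 1)" "0 \<le> y'" for u v and x' y' :: real
      proof -
        have "sqrt d * y' \<le> 2 ^ (L + 1) * 2 ^ (v + 1)" using that L(2) by (intro mult_mono) auto
        then have "(2::real) ^ u < 2 ^ (L + 1) * 2 ^ (v + 1)" using that by linarith
        then have "(2::real) ^ u < 2 ^ (v + L + 2)" by (simp add: power_add mult_ac)
        then have "u < v + L + 2" by (rule power_less_imp_less_exp[rotated]) simp
        then show ?thesis by simp
      qed
      have r2: "?k \<le> ?l + L + 1" using aux[OF k(1) 4(2) l(2) xy(2)] .
      have r3: "?l \<le> ?k + L + 1" using aux[OF l(1) 4(3) k(2) xy(1)] .
      have "(?k, ?l) \<in> R" using r1 r2 r3 level_le_n[OF _ _ X] level_le_n[OF _ _ Y] nz ij by (auto simp: R_def)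
      then have inP: "(i, j) \<in> P" using nz ij by (auto simp: P_def)
      have "A i j * (x * y) \<le> A i j * (2 ^ (?k + 1) * 2 ^ (?l + 1))" using xyle a by (rule mult_left_mono)
      also have "\<dots> = h (i, j)" by (simp add: h_def power_add)
      finally show ?thesis using nn inP unfolding xy by (auto split: if_splits)
    qed
  qed

  have "(\<Sum>i<n. \<Sum>j<n. if (i, j) \<in> P then h (i, j) else 0) = (\<Sum>ij\<in>{..<n} \<times> {..<n}. if ij \<in> P then h ij else 0)"
    unfolding sum.cartesian_product by (intro sum.cong) auto
  also have "\<dots> = sum h P"
    using P_sub by (subst sum.inter_restrict[symmetric]) (auto simp: Int_absorb1)
  also have "sum h P = (\<Sum>kl\<in>R. sum h {ij \<in> P. (\<lambda>(i, j). (lev (X i), lev (Y j))) ij = kl})"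
    by (rule sum.group[symmetric]) (use finP finR in \<open>auto simp: P_def\<close>)
  also have "\<dots> = (\<Sum>(k, l)\<in>R. 2 ^ (k + l + 2) * edge_weight A (S k) (T l))"
  proof (rule sum.cong[OF refl])
    fix kl assume kl: "kl \<in> R"
    obtain k l where [simp]: "kl = (k, l)" by (cases kl)
    have eq: "{ij \<in> P. (\<lambda>(i, j). (lev (X i), lev (Y j))) ij = kl} = S k \<times> T l"
      using kl by (auto simp: P_def S_def T_def)
    have "sum h {ij \<in> P. (\<lambda>(i, j). (lev (X i), lev (Y j))) ij = kl} = (\<Sum>ij\<in>S k \<times> T l. 2 ^ (k + l + 2) * A (fst ij) (snd ij))"
      unfolding eq by (rule sum.cong) (auto simp: h_def S_def T_def)
    also have "\<dots> = 2 ^ (k + l + 2) * edge_weight A (S k) (T l)"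
      by (simp add: edge_weight_def sum.cartesian_product sum_distrib_left case_prod_unfold)
    finally show "sum h {ij \<in> P. (\<lambda>(i, j). (lev (X i), lev (Y j))) ij = kl} = 
      (case kl of (k, l) \<Rightarrow> 2 ^ (k + l + 2) * edge_weight A (S k) (T l))" by simp
  qed
  also have "\<dots> \<le> (\<Sum>(k, l)\<in>R. 24 * real n * (2 * sqrt d) * (\<alpha> k * \<beta> l)
    + 48 * r * (real n * 2 ^ (L + 1)) *
       ((3 * (1 + real (k + (L + 1) - l)) * \<alpha> k + 1 / 2 ^ k) / 2 ^ (k + (L + 1) - l)
      + (3 * (1 + real (l + (L + 1) - k)) * \<beta> l + 1 / 2 ^ l) / 2 ^ (l + (L + 1) - k)))"
  proof (rule sum_mono, clarify)
    fix k l assume kl: "(k, l) \<in> R"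
    \<comment> \<open>The inequality \<open>sqrt d < 2 ^ (L + 1)\<close> yields the required bound
      with \<open>\<sigma> = 2 * sqrt d\<close>.\<close>
    have "d = sqrt d * sqrt d" using d by simp
    also have "\<dots> \<le> 2 ^ (L + 1) * sqrt d" using L d by (intro mult_right_mono) auto
    finally have dL: "d \<le> 2 ^ L * (2 * sqrt d)" by simp
    show "2 ^ (k + l + 2) * edge_weight A (S k) (T l) \<le> 24 * real n * (2 * sqrt d) * (\<alpha> k * \<beta> l)
    + 48 * r * (real n * 2 ^ (L + 1)) *
       ((3 * (1 + real (k + (L + 1) - l)) * \<alpha> k + 1 / 2 ^ k) / 2 ^ (k + (L + 1) - l)
      + (3 * (1 + real (l + (L + 1) - k)) * \<beta> l + 1 / 2 ^ l) / 2 ^ (l + (L + 1) - k))"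
      by (rule heavy_level_pair_le[OF disc n]) 
        (use r d kl dL \<alpha>0 \<beta>0 level_card[of k X] level_card[of l Y] in 
          \<open>auto simp: R_def S_def T_def \<alpha>_def \<beta>_def\<close>)
  qed
  also have "\<dots> = 48 * real n * sqrt d * (\<Sum>(k, l)\<in>R. \<alpha> k * \<beta> l) + 48 * r * (real n * 2 ^ (L + 1)) *
     ((\<Sum>(k, l)\<in>R. (3 * (1 + real (k + (L + 1) - l)) * \<alpha> k + 1 / 2 ^ k) / 2 ^ (k + (L + 1) - l))
    + (\<Sum>(k, l)\<in>R. (3 * (1 + real (l + (L + 1) - k)) * \<beta> l + 1 / 2 ^ l) / 2 ^ (l + (L + 1) - k)))"
    unfolding sum_distrib_left sum.distrib[symmetric] by (intro sum.cong) (auto simp: case_prod_unfold)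
  also have "\<dots> \<le> 48 * real n * sqrt d * 16 + 48 * r * (real n * (2 * sqrt d)) * (52 + 52)"
  proof (intro add_mono mult_left_mono mult_mono)
    have "(\<Sum>(k, l)\<in>R. \<alpha> k * \<beta> l) \<le> (\<Sum>(k, l)\<in>{..n} \<times> {..n}. \<alpha> k * \<beta> l)"
      using \<alpha>0 \<beta>0 by (intro sum_mono2) (auto simp: R_def)
    also have "\<dots> = (\<Sum>k\<le>n. \<alpha> k) * (\<Sum>l\<le>n. \<beta> l)" by (simp add: sum_product sum.cartesian_product)
    also have "\<dots> \<le> 4 * 4" using \<alpha>4 \<beta>4 \<alpha>0 \<beta>0 by (intro mult_mono sum_nonneg) auto
    finally show "(\<Sum>(k, l)\<in>R. \<alpha> k * \<beta> l) \<le> 16" by simp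
    \<comment> \<open>Enlarging \<open>R\<close> to all \<open>l \<le> k + L + 1\<close> adds
      non-negative terms and makes the exponent run through a full initial segment. The sum for
      \<open>\<beta>\<close> follows by exchanging the two levels, as \<open>R\<close> is
      symmetric.\<close>
    have "(\<Sum>(k, l)\<in>R. (3 * (1 + real (k + (L + 1) - l)) * \<alpha> k + 1 / 2 ^ k) / 2 ^ (k + (L + 1) - l))
       \<le> (\<Sum>(k, l)\<in>(SIGMA k:{..n}. {l. l \<le> k + (L + 1)}). (3 * (1 + real (k + (L + 1) - l)) * \<alpha> k + 1 / 2 ^ k) / 2 ^ (k + (L + 1) - l))"
      using \<alpha>0 by (intro sum_mono2) (auto simp: R_def)
    also have "\<dots> = (\<Sum>k\<le>n. \<Sum>l\<in>{l. l \<le> k + (L + 1)}. (3 * (1 + real (k + (L + 1) - l)) * \<alpha> k + 1 / 2 ^ k) / 2 ^ (k + (L + 1) - l))"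
      by (subst sum.Sigma) auto
    also have "\<dots> \<le> 52" by (rule dyadic_weight_sum_le[OF \<alpha>0 \<alpha>4])
    finally show "(\<Sum>(k, l)\<in>R. (3 * (1 + real (k + (L + 1) - l)) * \<alpha> k + 1 / 2 ^ k) / 2 ^ (k + (L + 1) - l)) \<le> 52" .
    have "(\<Sum>(k, l)\<in>R. (3 * (1 + real (l + (L + 1) - k)) * \<beta> l + 1 / 2 ^ l) / 2 ^ (l + (L + 1) - k))
       = (\<Sum>(l, k)\<in>R. (3 * (1 + real (l + (L + 1) - k)) * \<beta> l + 1 / 2 ^ l) / 2 ^ (l + (L + 1) - k))"
      by (rule sum.reindex_bij_witness[of _ prod.swap prod.swap]) (auto simp: R_def)
    also have "\<dots> \<le> (\<Sum>(k, l)\<in>(SIGMA k:{..n}. {l. l \<le> k + (L + 1)}). (3 * (1 + real (k + (L + 1) - l)) * \<beta> k + 1 / 2 ^ k) / 2 ^ (k + (L + 1) - l))"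
      using \<beta>0 by (intro sum_mono2) (auto simp: R_def)
    also have "\<dots> = (\<Sum>k\<le>n. \<Sum>l\<in>{l. l \<le> k + (L + 1)}. (3 * (1 + real (k + (L + 1) - l)) * \<beta> k + 1 / 2 ^ k) / 2 ^ (k + (L + 1) - l))"
      by (subst sum.Sigma) auto
    also have "\<dots> \<le> 52" by (rule dyadic_weight_sum_le[OF \<beta>0 \<beta>4])
    finally show "(\<Sum>(k, l)\<in>R. (3 * (1 + real (l + (L + 1) - k)) * \<beta> l + 1 / 2 ^ l) / 2 ^ (l + (L + 1) - k)) \<le> 52" .
    show "0 \<le> (\<Sum>(k, l)\<in>R. (3 * (1 + real (k + (L + 1) - l)) * \<alpha> k + 1 / 2 ^ k) / 2 ^ (k + (L + 1) - l))
      + (\<Sum>(k, l)\<in>R. (3 * (1 + real (l + (L + 1) - k)) * \<beta> l + 1 / 2 ^ l) / 2 ^ (l + (L + 1) - k))"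
      using \<alpha>0 \<beta>0 by (intro add_nonneg_nonneg sum_nonneg) auto
  qed (use r d L in \<open>auto intro!: mult_nonneg_nonneg\<close>)
  finally have main: "(\<Sum>i<n. \<Sum>j<n. if (i, j) \<in> P then h (i, j) else 0)
     \<le> 768 * (sqrt d * real n) + 9984 * (r * sqrt d * real n)" by (simp add: mult_ac)

  have "(\<Sum>i<n. \<Sum>j<n. if sqrt d < \<bar>real_of_int (X i * Y j)\<bar> then A i j * \<bar>real_of_int (X i * Y j)\<bar> else 0)
     \<le> (\<Sum>i<n. \<Sum>j<n. A i j * (real_of_int (X i))\<^sup>2 / sqrt d + A i j * (real_of_int (Y j))\<^sup>2 / sqrt d
        + (if (i, j) \<in> P then h (i, j) else 0))"
    by (intro sum_mono ptw) auto
  also have "\<dots> = (\<Sum>i<n. \<Sum>j<n. A i j * (real_of_int (X i))\<^sup>2) / sqrt d 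
     + (\<Sum>i<n. \<Sum>j<n. A i j * (real_of_int (Y j))\<^sup>2) / sqrt d
     + (\<Sum>i<n. \<Sum>j<n. if (i, j) \<in> P then h (i, j) else 0)"
    by (simp only: sum.distrib sum_divide_distrib)
  also have "\<dots> \<le> 56 * d * real n / sqrt d + 56 * d * real n / sqrt d
     + (768 * (sqrt d * real n) + 9984 * (r * sqrt d * real n))"
    using dX dY main d by (intro add_mono divide_right_mono) auto
  also have "56 * d * real n / sqrt d = 56 * (sqrt d * real n)"
    using d by (simp add: field_simps)
  also have "56 * (sqrt d * real n) + 56 * (sqrt d * real n) + (768 * (sqrt d * real n) + 9984 * (r * sqrt d * real n))
     = 880 * (sqrt d * real n) + 9984 * (r * sqrt d * real n)" by simp
  also have "\<dots> \<le> 880 * (r * sqrt d * real n) + 9984 * (r * sqrt d * real n)"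
    using r d by (intro add_mono mult_left_mono mult_right_mono) (auto simp: mult_le_cancel_right1)
  also have "\<dots> \<le> 11000 * r * sqrt d * real n" using r d by (simp add: mult_ac)
  finally show ?thesis .
qed

section \<open>Lattice points and level sets\<close>

text \<open>The radius fits the rounding of a real vector \<open>u\<close> with square sum at most
  \<open>n\<close>: from \<open>(\<bar>u i\<bar> + 1)^2 \<le> 2 * (u i)^2 + 2\<close> the square sum
  grows to at most \<open>4 * n\<close>. Extensionality off \<open>{..<n}\<close> makes the set
  finite.\<close>

definition lattice_ball :: "nat \<Rightarrow> (nat \<Rightarrow> int) set" where
  "lattice_ball n = {X \<in> {..<n} \<rightarrow>\<^sub>E UNIV. (\<Sum>i<n. (real_of_int (X i))\<^sup>2) \<le> 4 * real n}"

lemma sum_half_power_abs: "(\<Sum>z\<in>{- int N..int N}. (1 / 2 :: real) ^ nat \<bar>z\<bar>) = 3 - 2 / 2 ^ N"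
proof (induction N)
  case (Suc N)
  have eq: "{- int (Suc N)..int (Suc N)} = insert (- int (Suc N)) (insert (int (Suc N)) {- int N..int N})"
    by auto
  have "(\<Sum>z\<in>{- int (Suc N)..int (Suc N)}. (1 / 2 :: real) ^ nat \<bar>z\<bar>)
      = 2 * (1 / 2) ^ Suc N + (\<Sum>z\<in>{- int N..int N}. (1 / 2) ^ nat \<bar>z\<bar>)"
    unfolding eq by (simp add: nat_add_distrib)
  then show ?case unfolding Suc by (simp add: power_divide)
qed simp

text \<open>Each lattice point is given the weight \<open>2 ^ (4 n - \<Sum>|X i|) \<ge> 1\<close>, which makes the
  count a product of geometric series.\<close>

lemma finite_lattice_ball: "finite (lattice_ball n)"
  and card_lattice_ball: "real (card (lattice_ball n)) \<le> 48 ^ n"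
proof -
  define B where "B = ({..<n} \<rightarrow>\<^sub>E {- int (4 * n)..int (4 * n)})"
  have finB: "finite B" unfolding B_def by (intro finite_PiE) auto
  \<comment> \<open>For integers the square dominates the absolute value, so the bound on squares
    also bounds the sum of absolute values by \<open>4 * n\<close>.\<close>
  have sq: "\<bar>z\<bar> \<le> z\<^sup>2" for z :: int 
    by (metis abs_ge_zero abs_le_square_iff abs_mult_self_eq int_one_le_iff_zero_less le_less
        mult_le_cancel_left1 power2_eq_square not_less)
  have abs_le: "(\<Sum>i<n. nat \<bar>X i\<bar>) \<le> 4 * n" if "X \<in> lattice_ball n" for X
  proof -
    have "real_of_int (\<Sum>i<n. \<bar>X i\<bar>) \<le> real_of_int (\<Sum>i<n. (X i)\<^sup>2)"
      unfolding of_int_le_iff by (intro sum_mono sq)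
    also have "\<dots> \<le> 4 * real n" using that by (simp add: lattice_ball_def)
    finally have "(\<Sum>i<n. \<bar>X i\<bar>) \<le> 4 * int n" by linarith
    moreover have "(\<Sum>i<n. \<bar>X i\<bar>) = int (\<Sum>i<n. nat \<bar>X i\<bar>)" by simp
    ultimately show ?thesis by linarith
  qed
  have sub: "lattice_ball n \<subseteq> B"
  proof
    fix X assume X: "X \<in> lattice_ball n"
    have "X i \<in> {- int (4 * n)..int (4 * n)}" if "i < n" for i
    proof -
      have "nat \<bar>X i\<bar> \<le> (\<Sum>i<n. nat \<bar>X i\<bar>)" using that by (intro member_le_sum) auto
      then show ?thesis using abs_le[OF X] by auto
    qed
    then show "X \<in> B" using X by (auto simp: B_def lattice_ball_def PiE_iff)
  qed
  show "finite (lattice_ball n)" using sub finB by (rule finite_subset)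
  have "real (card (lattice_ball n)) = (\<Sum>X\<in>lattice_ball n. 1)" by simp
  also have "\<dots> \<le> (\<Sum>X\<in>lattice_ball n. 2 ^ (4 * n) * (\<Prod>i<n. (1 / 2) ^ nat \<bar>X i\<bar>))"
  proof (rule sum_mono)
    fix X assume X: "X \<in> lattice_ball n"
    have "(\<Prod>i<n. (1 / 2 :: real) ^ nat \<bar>X i\<bar>) = (1 / 2) ^ (\<Sum>i<n. nat \<bar>X i\<bar>)"
      by (simp add: power_sum)
    moreover have "(1 / 2 :: real) ^ (\<Sum>i<n. nat \<bar>X i\<bar>) \<ge> (1 / 2) ^ (4 * n)"
      using abs_le[OF X] by (intro power_decreasing) auto
    ultimately have "2 ^ (4 * n) * (1 / 2 :: real) ^ (4 * n) \<le> 2 ^ (4 * n) * (\<Prod>i<n. (1 / 2) ^ nat \<bar>X i\<bar>)"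
      by (intro mult_left_mono) auto
    then show "1 \<le> 2 ^ (4 * n) * (\<Prod>i<n. (1 / 2 :: real) ^ nat \<bar>X i\<bar>)"
      by (simp flip: power_mult_distrib)
  qed
  also have "\<dots> \<le> (\<Sum>X\<in>B. 2 ^ (4 * n) * (\<Prod>i<n. (1 / 2) ^ nat \<bar>X i\<bar>))"
    using sub finB by (intro sum_mono2) (auto intro!: mult_nonneg_nonneg prod_nonneg)
  also have "\<dots> = 2 ^ (4 * n) * (\<Prod>i<n. \<Sum>z\<in>{- int (4 * n)..int (4 * n)}. (1 / 2) ^ nat \<bar>z\<bar>)"
    unfolding B_def by (subst prod_sum_PiE) (auto simp: sum_distrib_left)
  also have "\<dots> \<le> 2 ^ (4 * n) * 3 ^ n"
  proof -
    have "2 / 2 ^ (4 * n) \<le> (2 :: real)" by (simp add: divide_le_eq)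
    then have "(3 - 2 / 2 ^ (4 * n)) ^ n \<le> (3 :: real) ^ n" by (intro power_mono) auto
    then show ?thesis unfolding sum_half_power_abs by simp
  qed
  also have "\<dots> = 48 ^ n" by (simp add: power_mult flip: power_mult_distrib)
  finally show "real (card (lattice_ball n)) \<le> 48 ^ n" .
qed

text \<open>With \<open>q = s / n\<close>, a single term of the binomial expansion gives
  \<open>(n choose s) * q ^ s \<le> (1 + q) ^ n \<le> exp s\<close>.\<close>

lemma binomial_le_exp_entropy:
  assumes "0 < s" "s \<le> n"
  shows "real (n choose s) \<le> exp (entropy n s)"
proof -
  let ?q = "real s / real n"
  have q: "0 < ?q" using assms by simp
  have "real (n choose s) * ?q ^ s \<le> (\<Sum>k\<le>n. real (n choose k) * ?q ^ k)"
    using assms by (intro member_le_sum[of s _ "\<lambda>k. real (n choose k) * ?q ^ k"]) auto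
  also have "\<dots> = (?q + 1) ^ n" by (subst binomial_ring) simp
  also have "\<dots> \<le> exp ?q ^ n" using exp_ge_add_one_self[of ?q] by (intro power_mono) (auto simp: add.commute)
  also have "\<dots> = exp (real s)" using assms by (simp flip: exp_of_nat_mult)
  finally have "real (n choose s) \<le> exp (real s) / ?q ^ s" using q by (simp add: pos_le_divide_eq del: divide_pos_pos)
  also have "\<dots> = exp (real s) * (real n / real s) ^ s" by (simp add: power_divide)
  also have "(real n / real s) ^ s = exp (real s * ln (real n / real s))"
    using assms by (simp add: exp_of_nat_mult)
  finally show ?thesis by (simp add: entropy_def algebra_simps exp_add)
qed

text \<open>The difference of the two sides is
  \<open>(s - 1 - ln s) + (s - 1) * (ln n - ln s)\<close>, a sum of non-negative terms; equality
  holds at \<open>s = 1\<close>.\<close>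

lemma entropy_ge:
  assumes "0 < s" "s \<le> n"
  shows "1 + ln (real n) \<le> entropy n s"
proof -
  have "ln (real s) \<le> real s - 1" using assms by (intro ln_le_minus_one) auto
  moreover have "(real s - 1) * ln (real s) \<le> (real s - 1) * ln (real n)"
    using assms by (intro mult_left_mono) auto
  moreover have eq: "ln (real n / real s) = ln (real n) - ln (real s)" using assms by (simp add: ln_div)
  ultimately show ?thesis unfolding entropy_def eq by (simp add: algebra_simps)
qed

text \<open>One entropy pays for the number of sets of size \<open>s\<close>. Because
  \<open>r \<ge> 1\<close>, at least \<open>3 * r\<close> entropies remain, each at least
  \<open>1 + ln n\<close>, so every size contributes at most \<open>exp (- 3 * r) / n ^ 3\<close>,
  and there are \<open>n\<close> sizes.\<close>

lemma sum_exp_entropy_le: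
  assumes r: "1 \<le> r" and n: "0 < n"
  shows "(\<Sum>S\<in>{S. S \<subseteq> {..<n} \<and> S \<noteq> {}}. exp (- 4 * r * entropy n (card S))) \<le> exp (- 3 * r) / (real n)\<^sup>2"
proof -
  let ?P = "{S. S \<subseteq> {..<n} \<and> S \<noteq> {}}"
  have fin: "finite ?P" by (rule finite_subset[of _ "Pow {..<n}"]) auto
  have card: "card S \<in> {1..n}" if "S \<in> ?P" for S
    using that card_mono[of "{..<n}" S] by (auto simp: Suc_le_eq card_gt_0_iff intro: finite_subset)
  have "(\<Sum>S\<in>?P. exp (- 4 * r * entropy n (card S))) = (\<Sum>s\<in>{1..n}. \<Sum>S\<in>{S \<in> ?P. card S = s}. exp (- 4 * r * entropy n (card S)))"
    by (rule sum.group[symmetric, OF fin]) (simp, use card in blast)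
  also have "\<dots> = (\<Sum>s\<in>{1..n}. real (n choose s) * exp (- 4 * r * entropy n s))"
  proof (rule sum.cong[OF refl])
    fix s assume s: "s \<in> {1..n}"
    have "{S \<in> ?P. card S = s} = {S. S \<subseteq> {..<n} \<and> card S = s}" using s by auto
    then have "card {S \<in> ?P. card S = s} = n choose s" using n_subsets[of "{..<n}" s] by simp
    then show "(\<Sum>S\<in>{S \<in> ?P. card S = s}. exp (- 4 * r * entropy n (card S))) = real (n choose s) * exp (- 4 * r * entropy n s)"
      by simp
  qed
  also have "\<dots> \<le> (\<Sum>s\<in>{1..n}. exp (- 3 * r) / (real n) ^ 3)"
  proof (rule sum_mono)
    fix s assume s: "s \<in> {1..n}"
    have e: "1 + ln (real n) \<le> entropy n s" "0 \<le> ln (real n)" using entropy_ge[of s n] s n by auto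
    have "real (n choose s) * exp (- 4 * r * entropy n s) \<le> exp (entropy n s) * exp (- 4 * r * entropy n s)"
      using s by (intro mult_right_mono binomial_le_exp_entropy) auto
    also have "\<dots> = exp ((1 - 4 * r) * entropy n s)" by (simp add: algebra_simps flip: exp_add)
    also have "\<dots> \<le> exp ((- 3 * r) * entropy n s)"
      unfolding exp_le_cancel_iff by (rule mult_right_mono) (use e r in auto)
    also have "\<dots> \<le> exp ((- 3 * r) * (1 + ln (real n)))"
      unfolding exp_le_cancel_iff by (rule mult_left_mono_neg) (use e r in auto)
    also have "\<dots> \<le> exp (- 3 * r - 3 * ln (real n))"
      using e r mult_right_mono[of 1 r "ln (real n)"] by (auto simp: algebra_simps)
    also have "\<dots> = exp (- 3 * r) / exp (ln (real n)) ^ 3"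
      by (simp add: exp_diff flip: exp_of_nat_mult)
    finally show "real (n choose s) * exp (- 4 * r * entropy n s) \<le> exp (- 3 * r) / real n ^ 3"
      using n by simp
  qed
  also have "\<dots> = exp (- 3 * r) / (real n)\<^sup>2" using n by (simp add: field_simps power2_eq_square power3_eq_cube)
  finally show ?thesis .
qed

text \<open>Beyond \<open>2 * r\<close> one has \<open>t - r \<ge> t / 2\<close> and
  \<open>exp (t / 2) \<ge> t^2 / 8\<close>. This converts a bound on exponentials of size
  \<open>exp r\<close> into one on squares of size \<open>r^2\<close>.\<close>

lemma square_le_exp:
  fixes t r :: real
  assumes "0 \<le> t"
  shows "t\<^sup>2 \<le> 4 * r\<^sup>2 + 8 * exp (t - r)"
proof (cases "t \<le> 2 * r")
  case True
  then have "t\<^sup>2 \<le> (2 * r)\<^sup>2" using assms by (intro power_mono) auto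
  then show ?thesis by (simp add: power_mult_distrib) (smt (verit) exp_gt_zero)
next
  case False
  have "1 + t / 2 + (t / 2)\<^sup>2 / 2 \<le> exp (t / 2)" using assms by (intro exp_lower_Taylor_quadratic) auto
  also have "\<dots> \<le> exp (t - r)" using False by simp
  finally have "t\<^sup>2 \<le> 8 * exp (t - r)" using assms by (simp add: power_divide)
  then show ?thesis by (smt (verit) zero_le_power2)
qed

section \<open>The good event\<close>

context inhom_ER
begin

section \<open>Light pairs: a Bernstein bound uniform over lattice points\<close>

definition light_sum :: "(nat \<Rightarrow> nat \<Rightarrow> real) \<Rightarrow> (nat \<Rightarrow> int) \<Rightarrow> (nat \<Rightarrow> int) \<Rightarrow> real" where
  "light_sum A X Y = (\<Sum>i<n. \<Sum>j<n. if \<bar>real_of_int (X i * Y j)\<bar> \<le> sqrt d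
     then (A i j - p i j) * real_of_int (X i * Y j) else 0)"

definition light_bounded :: "(nat \<Rightarrow> nat \<Rightarrow> real) \<Rightarrow> bool" where
  "light_bounded A \<longleftrightarrow> (\<forall>X\<in>lattice_ball n. \<forall>Y\<in>lattice_ball n.
     light_sum A X Y
       \<le> 42 * sqrt d * real n)"

text \<open>The truncation makes the weights \<open>X i * Y j / (2 * sqrt d)\<close> at most
  \<open>1 / 2\<close> in absolute value. Their variance sum is at most
  \<open>(4 n) * (4 n) / (4 n) = 4 n\<close>, so the exponential moment is at most
  \<open>exp (8 n)\<close>. In this scaling the threshold is \<open>21 n\<close>, which leaves
  \<open>exp (- 13 n)\<close>.\<close>

lemma light_sum_tail:
  assumes X: "X \<in> lattice_ball n" and Y: "Y \<in> lattice_ball n"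
  shows "measure_pmf.prob (ER_adj n p) {A. 42 * sqrt d * real n <
     light_sum A X Y}
     \<le> exp (- 13 * real n)"
proof -
  define w where "w i j = (if \<bar>real_of_int (X i * Y j)\<bar> \<le> sqrt d then real_of_int (X i * Y j) / (2 * sqrt d) else 0)" for i j
  have sd: "0 < sqrt d" using d_ge_1 by simp
  have w: "\<bar>w i j\<bar> \<le> 1 / 2" for i j using sd by (auto simp: w_def divide_le_eq)
  have "(\<Sum>i<n. \<Sum>j<n. p i j * (w i j)\<^sup>2) \<le> (\<Sum>i<n. \<Sum>j<n. (real_of_int (X i))\<^sup>2 * (real_of_int (Y j))\<^sup>2 / (4 * real n))"
  proof (intro sum_mono)
    fix i j assume ij: "i \<in> {..<n}" "j \<in> {..<n}"
    have "(w i j)\<^sup>2 \<le> (real_of_int (X i * Y j) / (2 * sqrt d))\<^sup>2" by (simp add: w_def)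
    also have "\<dots> = (real_of_int (X i))\<^sup>2 * (real_of_int (Y j))\<^sup>2 / (4 * d)"
      using d_ge_1 by (simp add: power_divide power_mult_distrib)
    finally have "p i j * (w i j)\<^sup>2 \<le> (d / real n) * ((real_of_int (X i))\<^sup>2 * (real_of_int (Y j))\<^sup>2 / (4 * d))"
      using ij p_le p_nonneg d_ge_1 by (intro mult_mono) auto
    also have "\<dots> = (real_of_int (X i))\<^sup>2 * (real_of_int (Y j))\<^sup>2 / (4 * real n)"
      using d_ge_1 by simp
    finally show "p i j * (w i j)\<^sup>2 \<le> (real_of_int (X i))\<^sup>2 * (real_of_int (Y j))\<^sup>2 / (4 * real n)" .
  qed
  also have "\<dots> = (\<Sum>i<n. (real_of_int (X i))\<^sup>2) * (\<Sum>j<n. (real_of_int (Y j))\<^sup>2) / (4 * real n)"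
    by (simp add: sum_product sum_divide_distrib)
  also have "\<dots> \<le> (4 * real n) * (4 * real n) / (4 * real n)"
    using X Y unfolding lattice_ball_def by (intro divide_right_mono mult_mono sum_nonneg) auto
  finally have "exp (2 * (\<Sum>i<n. \<Sum>j<n. p i j * (w i j)\<^sup>2)) \<le> exp (8 * real n)"
    using n_pos by simp
  then have mgf: "measure_pmf.expectation (ER_adj n p) (\<lambda>A. exp (\<Sum>i<n. \<Sum>j<n. w i j * (A i j - p i j))) \<le> exp (8 * real n)"
    using w by (intro order_trans[OF centered_mgf_le]) auto
  have eq: "(\<Sum>i<n. \<Sum>j<n. w i j * (A i j - p i j)) = 
     light_sum A X Y / (2 * sqrt d)" for A
    unfolding light_sum_def sum_divide_distrib by (intro sum.cong) (auto simp: w_def)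
  have "measure_pmf.prob (ER_adj n p) {A. 42 * sqrt d * real n <
     light_sum A X Y}
     \<le> measure_pmf.prob (ER_adj n p) {A. 21 * real n \<le> (\<Sum>i<n. \<Sum>j<n. w i j * (A i j - p i j))}"
    unfolding eq using sd by (intro measure_pmf.finite_measure_mono) (auto simp: pos_le_divide_eq mult_ac)
  also have "\<dots> \<le> exp (8 * real n - 21 * real n)" by (rule prob_Chernoff[OF mgf])
  finally show ?thesis by simp
qed

text \<open>There are at most \<open>48 ^ n * 48 ^ n = 2304 ^ n\<close> pairs of lattice points. As
  \<open>2304 \<le> 2 ^ 12 \<le> exp 12\<close>, the union bound leaves
  \<open>exp (- n)\<close>.\<close>

lemma prob_not_light_bounded: "measure_pmf.prob (ER_adj n p) {A. \<not> light_bounded A} \<le> exp (- real n)"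
proof -
  let ?V = "lattice_ball n"
  let ?B = "\<lambda>XY. {A. 42 * sqrt d * real n < light_sum A (fst XY) (snd XY)}"
  have "{A. \<not> light_bounded A} = (\<Union>XY\<in>?V \<times> ?V. ?B XY)"
    unfolding light_bounded_def by (fastforce simp: not_le)
  then have "measure_pmf.prob (ER_adj n p) {A. \<not> light_bounded A} \<le> (\<Sum>XY\<in>?V \<times> ?V. measure_pmf.prob (ER_adj n p) (?B XY))"
    using finite_lattice_ball by (auto intro!: measure_UNION_le)
  also have "\<dots> \<le> (\<Sum>XY\<in>?V \<times> ?V. exp (- 13 * real n))"
    by (intro sum_mono light_sum_tail) auto
  also have "\<dots> = real (card ?V) * real (card ?V) * exp (- 13 * real n)" by (simp add: card_cartesian_product)
  also have "\<dots> \<le> 48 ^ n * 48 ^ n * exp (- 13 * real n)"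
    by (intro mult_right_mono mult_mono card_lattice_ball) auto
  also have "\<dots> \<le> exp (12 * real n) * exp (- 13 * real n)"
  proof (rule mult_right_mono)
    have "(48::real) ^ n * 48 ^ n = 2304 ^ n" by (simp flip: power_mult_distrib)
    also have "\<dots> \<le> (2 ^ 12) ^ n" by (intro power_mono) auto
    also have "\<dots> \<le> (exp 1 ^ 12) ^ n" using exp_ge_add_one_self[of 1] by (intro power_mono) auto
    also have "\<dots> = exp (12 * real n)" by (simp add: mult.commute flip: exp_of_nat_mult)
    finally show "(48::real) ^ n * 48 ^ n \<le> exp (12 * real n)" .
  qed simp
  also have "\<dots> = exp (- real n)" by (simp flip: exp_add)
  finally show ?thesis .
qed

section \<open>Edge counts between vertex sets\<close>

lemma edge_weight_tail:
  assumes S: "S \<subseteq> {..<n}" and T: "T \<subseteq> {..<n}"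
  shows "measure_pmf.prob (ER_adj n p) {A. 3 / 2 * (d * real (card S) * real (card T) / real n) * 2 ^ m
        + 3 * b < real m * edge_weight A S T} \<le> exp (- b)"
proof -
  \<comment> \<open>The weight is \<open>m / 3\<close> because \<open>mgf_le\<close> doubles it and
    \<open>exp (2 / 3) \<le> 2\<close>; the mean is then multiplied by at most \<open>2 ^ m\<close>.
    Clearing the factor 3 at the end produces the constants \<open>3 / 2\<close> and
    \<open>3\<close>.\<close>
  define w where "w i j = (if i \<in> S \<and> j \<in> T then real m / 3 else 0)" for i j
  let ?\<mu> = "d * real (card S) * real (card T) / real n"
  have restrict: "(\<Sum>i<n. \<Sum>j<n. if i \<in> S \<and> j \<in> T then f i j else 0) = (\<Sum>i\<in>S. \<Sum>j\<in>T. f i j)" for f :: "nat \<Rightarrow> nat \<Rightarrow> real"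
  proof -
    have "(\<Sum>i<n. \<Sum>j<n. if i \<in> S \<and> j \<in> T then f i j else 0) = (\<Sum>i<n. if i \<in> S then \<Sum>j<n. if j \<in> T then f i j else 0 else 0)"
      by (intro sum.cong) auto
    also have "\<dots> = (\<Sum>i\<in>{..<n} \<inter> S. \<Sum>j\<in>{..<n} \<inter> T. f i j)" by (simp add: sum.inter_restrict)
    finally show ?thesis using S T by (simp add: Int_absorb1)
  qed
  \<comment> \<open>It is enough that \<open>exp 2 \<le> 2.72^2 \<le> 8\<close>; cube roots give
    \<open>exp (2 / 3) \<le> 2\<close>.\<close>
  have e: "exp (2 * (real m / 3)) \<le> 2 ^ m"
  proof -
    have "exp (2 / 3) ^ 3 = exp (2::real)" by (simp flip: exp_of_nat_mult)
    also have "\<dots> = exp 1 ^ 2" by (simp flip: exp_of_nat_mult)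
    also have "\<dots> \<le> (272 / 100) ^ 2" using e_less_272 by (intro power_mono) auto
    also have "\<dots> \<le> 2 ^ 3" by (simp add: power2_eq_square)
    finally have "exp (2 / 3 :: real) \<le> 2" by (rule power_mono_iff[THEN iffD1, rotated 3]) auto
    then have "exp (2 / 3 :: real) ^ m \<le> 2 ^ m" by (intro power_mono) auto
    then show ?thesis by (simp add: mult.commute flip: exp_of_nat_mult)
  qed
  have "(\<Sum>i<n. \<Sum>j<n. p i j * (exp (2 * w i j) - 1)) = (\<Sum>i<n. \<Sum>j<n. if i \<in> S \<and> j \<in> T then p i j * (exp (2 * (real m / 3)) - 1) else 0)"
    by (intro sum.cong) (auto simp: w_def)
  also have "\<dots> = (\<Sum>i\<in>S. \<Sum>j\<in>T. p i j * (exp (2 * (real m / 3)) - 1))" by (rule restrict)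
  also have "\<dots> \<le> (\<Sum>i\<in>S. \<Sum>j\<in>T. d / real n * 2 ^ m)"
    using S T p_le p_nonneg d_ge_1 e by (intro sum_mono mult_mono) (auto intro: p_le)
  also have "\<dots> = ?\<mu> * 2 ^ m" by simp
  finally have le: "(\<Sum>i<n. \<Sum>j<n. p i j * (exp (2 * w i j) - 1)) / 2 \<le> ?\<mu> * 2 ^ m / 2"
    by (rule divide_right_mono) simp
  have mgf: "measure_pmf.expectation (ER_adj n p) (\<lambda>A. exp (\<Sum>i<n. \<Sum>j<n. w i j * A i j)) \<le> exp (?\<mu> * 2 ^ m / 2)"
    by (rule order_trans[OF mgf_le]) (use le in simp)
  have eq: "(\<Sum>i<n. \<Sum>j<n. w i j * A i j) = real m * edge_weight A S T / 3" for A
  proof -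
    have "(\<Sum>i<n. \<Sum>j<n. w i j * A i j) = (\<Sum>i<n. \<Sum>j<n. if i \<in> S \<and> j \<in> T then real m / 3 * A i j else 0)"
      by (intro sum.cong) (auto simp: w_def)
    also have "\<dots> = (\<Sum>i\<in>S. \<Sum>j\<in>T. real m / 3 * A i j)" by (rule restrict)
    finally show ?thesis by (simp add: edge_weight_def sum_distrib_left sum_divide_distrib)
  qed
  have "measure_pmf.prob (ER_adj n p) {A. 3 / 2 * ?\<mu> * 2 ^ m + 3 * b < real m * edge_weight A S T}
     \<le> measure_pmf.prob (ER_adj n p) {A. ?\<mu> * 2 ^ m / 2 + b \<le> (\<Sum>i<n. \<Sum>j<n. w i j * A i j)}"
    unfolding eq by (intro measure_pmf.finite_measure_mono) (auto simp: pos_le_divide_eq)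
  also have "\<dots> \<le> exp (?\<mu> * 2 ^ m / 2 - (?\<mu> * 2 ^ m / 2 + b))" by (rule prob_Chernoff[OF mgf])
  finally show ?thesis by simp
qed

text \<open>Choosing the tail parameter as \<open>4 * r\<close> times the sum of both entropies
  makes the union bound over \<open>S\<close> and \<open>T\<close> a product. With the
  \<open>4 * n\<close> tilts it is at most \<open>4 * exp (- 6 * r)\<close>, and
  \<open>16 \<le> exp (5 * r)\<close> finishes.\<close>

lemma prob_not_discrepancy:
  assumes r: "1 \<le> r"
  shows "measure_pmf.prob (ER_adj n p) {A. \<not> discrepancy n d r A} \<le> exp (- r) / 4"
proof -
  let ?P = "{S. S \<subseteq> {..<n} \<and> S \<noteq> {}}"
  let ?I = "{1..4 * n} \<times> ?P \<times> ?P"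
  let ?f = "\<lambda>S. exp (- 4 * r * entropy n (card S))"
  let ?B = "\<lambda>(m, S, T). {A. 3 / 2 * (d * real (card S) * real (card T) / real n) * 2 ^ m
        + 12 * r * (entropy n (card S) + entropy n (card T)) < real m * edge_weight A S T}"
  have fin: "finite ?P" by (rule finite_subset[of _ "Pow {..<n}"]) auto
  have "{A. \<not> discrepancy n d r A} \<subseteq> (\<Union>x\<in>?I. ?B x)"
  proof
    fix A assume "A \<in> {A. \<not> discrepancy n d r A}"
    then obtain S T m where "S \<in> ?P" "T \<in> ?P" "m \<in> {1..4 * n}" "A \<in> ?B (m, S, T)"
      unfolding discrepancy_def by (auto simp: not_le)
    then show "A \<in> (\<Union>x\<in>?I. ?B x)" by (intro UN_I[of "(m, S, T)"]) simp_all
  qed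
  then have "measure_pmf.prob (ER_adj n p) {A. \<not> discrepancy n d r A} \<le> measure_pmf.prob (ER_adj n p) (\<Union>x\<in>?I. ?B x)"
    by (intro measure_pmf.finite_measure_mono) auto
  also have "\<dots> \<le> (\<Sum>x\<in>?I. measure_pmf.prob (ER_adj n p) (?B x))"
    using fin by (intro measure_UNION_le) auto
  also have "\<dots> \<le> (\<Sum>(m, S, T)\<in>?I. ?f S * ?f T)"
  proof (rule sum_mono, clarify)
    fix m S T assume "S \<subseteq> {..<n}" "T \<subseteq> {..<n}"
    from edge_weight_tail[OF this, of m "4 * r * (entropy n (card S) + entropy n (card T))"]
    show "measure_pmf.prob (ER_adj n p) {A. 3 / 2 * (d * real (card S) * real (card T) / real n) * 2 ^ m
        + 12 * r * (entropy n (card S) + entropy n (card T)) < real m * edge_weight A S T} \<le> ?f S * ?f T"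
      by (simp add: algebra_simps flip: exp_add)
  qed
  also have "\<dots> = real (4 * n) * (sum ?f ?P * sum ?f ?P)"
    by (simp add: sum_product sum.cartesian_product[symmetric])
  also have "\<dots> \<le> real (4 * n) * (exp (- 3 * r) / (real n)\<^sup>2 * (exp (- 3 * r) / (real n)\<^sup>2))"
    using sum_exp_entropy_le[OF r, of n] n_pos by (intro mult_left_mono mult_mono sum_nonneg) auto
  also have "\<dots> = 4 * exp (- 6 * r) / real n ^ 3"
    using n_pos by (simp add: field_simps power2_eq_square power3_eq_cube flip: exp_add)
  also have "\<dots> \<le> 4 * exp (- 6 * r) / 1" using n_pos by (intro divide_left_mono) auto
  also have "\<dots> \<le> exp (- r) / 4"
  proof -
    have "(2::real) ^ 5 \<le> exp 1 ^ 5" using exp_ge_add_one_self[of 1] by (intro power_mono) auto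
    also have "\<dots> = exp 5" by (simp flip: exp_of_nat_mult)
    also have "\<dots> \<le> exp (5 * r)" using r by simp
    finally have "16 * exp (- 6 * r) \<le> exp (5 * r) * exp (- 6 * r)" by (intro mult_right_mono) auto
    then show ?thesis by (simp flip: exp_add)
  qed
  finally show ?thesis .
qed

section \<open>Mean square fluctuation of the degrees\<close>

definition degrees_bounded :: "real \<Rightarrow> (nat \<Rightarrow> nat \<Rightarrow> real) \<Rightarrow> bool" where
  "degrees_bounded r A \<longleftrightarrow> (\<Sum>i<n. (row_deg n A i - row_deg n p i)\<^sup>2) \<le> 528 * r\<^sup>2 * d * real n"

text \<open>The weight matrix is \<open>c\<close> on row \<open>i\<close> and zero elsewhere. The
  expected degree is at most \<open>d\<close>, so the exponent is at most
  \<open>2 * c^2 * d = 1 / 2\<close>, and \<open>exp (1 / 2) \<le> 2\<close>.\<close>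

lemma expectation_exp_degree_le:
  assumes i: "i < n" and c: "\<bar>c\<bar> = 1 / (2 * sqrt d)"
  shows "measure_pmf.expectation (ER_adj n p) (\<lambda>A. exp (c * (row_deg n A i - row_deg n p i))) \<le> 2"
proof -
  define w where "w i' j = (if i' = i then c else 0)" for i' and j :: nat
  have l2: "c\<^sup>2 = 1 / (4 * d)" using c d_ge_1 
    by (metis power2_abs power_divide power_one power_mult_distrib real_sqrt_pow2 order_trans zero_le_one four_x_squared mult.commute)
  have eq: "(\<Sum>i'<n. \<Sum>j<n. w i' j * f i' j) = c * (\<Sum>j<n. f i j)" for f :: "nat \<Rightarrow> nat \<Rightarrow> real"
  proof -
    have "(\<Sum>i'<n. \<Sum>j<n. w i' j * f i' j) = (\<Sum>i'<n. if i' = i then c * (\<Sum>j<n. f i' j) else 0)"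
      by (intro sum.cong) (auto simp: w_def sum_distrib_left)
    then show ?thesis using i by simp
  qed
  have "measure_pmf.expectation (ER_adj n p) (\<lambda>A. exp (c * (row_deg n A i - row_deg n p i)))
    = measure_pmf.expectation (ER_adj n p) (\<lambda>A. exp (\<Sum>i'<n. \<Sum>j<n. w i' j * (A i' j - p i' j)))"
    unfolding eq by (simp add: row_deg_def sum_subtractf)
  also have "\<dots> \<le> exp (2 * (\<Sum>i'<n. \<Sum>j<n. p i' j * (w i' j)\<^sup>2))"
  proof (rule centered_mgf_le)
    have "1 / (2 * sqrt d) \<le> 1 / 2" using d_ge_1 by (simp add: divide_le_eq)
    then show "\<bar>w i' j\<bar> \<le> 1 / 2" for i' j using c by (simp add: w_def)
  qed
  also have "(\<Sum>i'<n. \<Sum>j<n. p i' j * (w i' j)\<^sup>2) = (\<Sum>i'<n. \<Sum>j<n. w i' j * (c * p i' j))"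
    by (intro sum.cong) (auto simp: w_def power2_eq_square)
  also have "\<dots> = c * (\<Sum>j<n. c * p i j)" by (rule eq)
  also have "\<dots> = c\<^sup>2 * (\<Sum>j<n. p i j)" by (simp add: power2_eq_square sum_distrib_left mult_ac)
  also have "exp (2 * (c\<^sup>2 * (\<Sum>j<n. p i j))) \<le> exp (2 * (c\<^sup>2 * (\<Sum>j<n. d / real n)))"
    unfolding exp_le_cancel_iff using i p_le by (intro mult_left_mono sum_mono) auto
  also have "\<dots> = exp (1 / 2)" using d_ge_1 n_pos by (simp add: l2)
  also have "\<dots> \<le> 2" using real_exp_bound_lemma[of "1/2"] by simp
  finally show ?thesis .
qed

text \<open>Markov's inequality needs no independence between rows: the mean of
  \<open>\<Sum>i<n. exp (t A i)\<close> is at most \<open>4 * n\<close>, since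
  \<open>exp \<bar>u\<bar> \<le> exp u + exp (- u)\<close>, and the threshold is
  \<open>16 * n * exp r\<close>. Below it \<open>square_le_exp\<close> gives
  \<open>4 * d * n * (4 * r^2 + 128)\<close>, whence \<open>528 = 4 * (4 + 128)\<close>.\<close>

lemma prob_not_degrees_bounded:
  assumes r: "1 \<le> r"
  shows "measure_pmf.prob (ER_adj n p) {A. \<not> degrees_bounded r A} \<le> exp (- r) / 4"
proof -
  define t where "t A i = \<bar>row_deg n A i - row_deg n p i\<bar> / (2 * sqrt d)" for A i
  have t0: "0 \<le> t A i" for A i using d_ge_1 by (simp add: t_def)
  let ?f = "\<lambda>A. \<Sum>i<n. exp (t A i)"
  have sub: "16 * real n * exp r \<le> ?f A" if "\<not> degrees_bounded r A" for A
  proof (rule ccontr)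
    assume "\<not> 16 * real n * exp r \<le> ?f A"
    then have f: "?f A \<le> 16 * real n * exp r" by simp
    have "(\<Sum>i<n. (row_deg n A i - row_deg n p i)\<^sup>2) = (\<Sum>i<n. 4 * d * (t A i)\<^sup>2)"
      using d_ge_1 by (intro sum.cong) (auto simp: t_def power_divide power_mult_distrib)
    also have "\<dots> \<le> (\<Sum>i<n. 4 * d * (4 * r\<^sup>2 + 8 * exp (t A i - r)))"
      using d_ge_1 by (intro sum_mono mult_left_mono square_le_exp t0) auto
    also have "\<dots> = 4 * d * (4 * r\<^sup>2 * real n + 8 * exp (- r) * ?f A)"
      by (simp add: sum_distrib_left sum.distrib algebra_simps exp_diff exp_minus divide_inverse)
    also have "\<dots> \<le> 4 * d * (4 * r\<^sup>2 * real n + 8 * exp (- r) * (16 * real n * exp r))"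
      using f d_ge_1 by (intro mult_left_mono add_mono) auto
    also have "\<dots> = 4 * d * real n * (4 * r\<^sup>2 + 128)"
      by (simp add: algebra_simps exp_minus)
    also have "\<dots> \<le> 4 * d * real n * (4 * r\<^sup>2 + 128 * r\<^sup>2)"
      using d_ge_1 r by (intro mult_left_mono add_mono) auto
    finally have "degrees_bounded r A" by (simp add: degrees_bounded_def algebra_simps)
    then show False using that by simp
  qed
  have "measure_pmf.prob (ER_adj n p) {A. \<not> degrees_bounded r A} \<le> measure_pmf.prob (ER_adj n p) {A. 16 * real n * exp r \<le> ?f A}"
    using sub by (intro measure_pmf.finite_measure_mono) auto
  also have "\<dots> \<le> measure_pmf.expectation (ER_adj n p) ?f / (16 * real n * exp r)"
    using n_pos by (intro prob_Markov sum_nonneg) auto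
  also have "measure_pmf.expectation (ER_adj n p) ?f = (\<Sum>i<n. measure_pmf.expectation (ER_adj n p) (\<lambda>A. exp (t A i)))"
    by (rule Bochner_Integration.integral_sum) simp
  also have "\<dots> \<le> (\<Sum>i<n. 4)"
  proof (rule sum_mono)
    fix i assume i: "i \<in> {..<n}"
    define c where "c = 1 / (2 * sqrt d)"
    have "measure_pmf.expectation (ER_adj n p) (\<lambda>A. exp (t A i)) \<le>
       measure_pmf.expectation (ER_adj n p) (\<lambda>A. exp (c * (row_deg n A i - row_deg n p i)) + exp (- c * (row_deg n A i - row_deg n p i)))"
    proof (rule integral_mono)
      fix A
      have "t A i = c * (row_deg n A i - row_deg n p i) \<or> t A i = - c * (row_deg n A i - row_deg n p i)"
        by (auto simp: t_def c_def abs_if diff_divide_distrib)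
      then show "exp (t A i) \<le> exp (c * (row_deg n A i - row_deg n p i)) + exp (- c * (row_deg n A i - row_deg n p i))"
        by (metis add.commute add_increasing exp_ge_zero order_refl)
    qed simp_all
    also have "\<dots> = measure_pmf.expectation (ER_adj n p) (\<lambda>A. exp (c * (row_deg n A i - row_deg n p i)))
      + measure_pmf.expectation (ER_adj n p) (\<lambda>A. exp (- c * (row_deg n A i - row_deg n p i)))"
      by (rule Bochner_Integration.integral_add) simp_all
    also have "\<dots> \<le> 2 + 2"
      using i d_ge_1 by (intro add_mono expectation_exp_degree_le) (auto simp: c_def)
    finally show "measure_pmf.expectation (ER_adj n p) (\<lambda>A. exp (t A i)) \<le> 4" by simp
  qed
  finally show ?thesis using n_pos by (simp add: divide_right_mono exp_minus field_simps)
qed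

end

section \<open>Bilinear forms of normalized matrices\<close>

definition bil :: "nat \<Rightarrow> (nat \<Rightarrow> nat \<Rightarrow> real) \<Rightarrow> (nat \<Rightarrow> real) \<Rightarrow> (nat \<Rightarrow> real) \<Rightarrow> real" where
  "bil n M x y = (\<Sum>i<n. \<Sum>j<n. M i j * x i * y j)"

text \<open>The part subtracted from the identity in \<open>sym_lap\<close>; differences of
  Laplacians are differences of these matrices up to sign.\<close>

definition norm_adj :: "nat \<Rightarrow> (nat \<Rightarrow> nat \<Rightarrow> real) \<Rightarrow> nat \<Rightarrow> nat \<Rightarrow> real" where
  "norm_adj n M i j = M i j / (sqrt (row_deg n M i) * sqrt (row_deg n M j))"

lemma bil_add: "bil n (\<lambda>i j. M i j + N i j) x y = bil n M x y + bil n N x y"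
  by (simp add: bil_def algebra_simps sum.distrib)

lemma bil_diff: "bil n (\<lambda>i j. M i j - N i j) x y = bil n M x y - bil n N x y"
  by (simp add: bil_def algebra_simps sum_subtractf)

lemma bil_minus_left: "bil n M (\<lambda>i. - x i) y = - bil n M x y"
  by (simp add: bil_def sum_negf)

lemma bil_scale_left: "bil n M (\<lambda>i. c * x i) y = c * bil n M x y"
  by (simp add: bil_def sum_distrib_left mult_ac)

lemma bil_scale_right: "bil n M x (\<lambda>i. c * y i) = c * bil n M x y"
  by (simp add: bil_def sum_distrib_left mult_ac)

text \<open>Test the form with the normalized image of \<open>y\<close>: for
  \<open>x = M y / \<bar>M y\<bar>\<close> its value is the length of \<open>M y\<close>.\<close>

lemma spec_norm_leI:
  assumes "0 \<le> B" 
    and bil: "\<And>x y. (\<Sum>i<n. (x i)\<^sup>2) \<le> 1 \<Longrightarrow> (\<Sum>i<n. (y i)\<^sup>2) \<le> 1 \<Longrightarrow> bil n M x y \<le> B"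
  shows "spec_norm n M \<le> B"
  unfolding spec_norm_def
proof (rule cSUP_least)
  show "{x::nat \<Rightarrow> real. (\<Sum>i<n. (x i)\<^sup>2) \<le> 1} \<noteq> {}" by (auto intro!: exI[of _ "\<lambda>_. 0"])
next
  fix y :: "nat \<Rightarrow> real" assume "y \<in> {x. (\<Sum>i<n. (x i)\<^sup>2) \<le> 1}"
  then have y: "(\<Sum>i<n. (y i)\<^sup>2) \<le> 1" by simp
  define v where "v i = (\<Sum>j<n. M i j * y j)" for i
  define N where "N = (\<Sum>i<n. (v i)\<^sup>2)"
  show "sqrt (\<Sum>i<n. (\<Sum>j<n. M i j * y j)\<^sup>2) \<le> B"
  proof (cases "N = 0")
    case True
    then show ?thesis using assms(1) by (simp add: N_def v_def)
  next
    case False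
    then have N: "0 < N" using sum_nonneg[of "{..<n}" "\<lambda>i. (v i)\<^sup>2"] by (simp add: N_def)
    define x where "x i = (1 / sqrt N) * v i" for i
    have "(\<Sum>i<n. (x i)\<^sup>2) = N / N"
      using N by (simp add: x_def power_mult_distrib power_divide N_def flip: sum_divide_distrib)
    then have x: "(\<Sum>i<n. (x i)\<^sup>2) \<le> 1" using N by simp
    have "bil n M x y = (1 / sqrt N) * bil n M v y" unfolding x_def by (rule bil_scale_left)
    also have "bil n M v y = N"
      unfolding bil_def N_def power2_eq_square
      by (intro sum.cong refl) (simp add: v_def sum_distrib_left sum_distrib_right mult_ac)
    also have "1 / sqrt N * N = sqrt N" using N by (simp add: real_div_sqrt)
    finally show ?thesis using bil[OF x y] by (simp add: N_def v_def)
  qed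
qed

lemma mult_le_half_squares: "a * b \<le> (a\<^sup>2 + b\<^sup>2) / (2::real)"
  using sum_squares_bound[of a b] by simp

text \<open>Apply \<open>a * b \<le> (a^2 + b^2) / 2\<close> to \<open>a = x i / sqrt (D i)\<close>
  and \<open>b = y j / sqrt (D j)\<close>. Summing \<open>M\<close> along rows cancels the degrees;
  symmetry of \<open>M\<close> turns the columns met by \<open>y\<close> into rows.\<close>

lemma bil_norm_adj_le_1:
  assumes M: "\<And>i j. i < n \<Longrightarrow> j < n \<Longrightarrow> 0 \<le> M i j" "\<And>i j. i < n \<Longrightarrow> j < n \<Longrightarrow> M i j = M j i"
    and deg: "\<And>i. i < n \<Longrightarrow> 0 < row_deg n M i"
    and x: "(\<Sum>i<n. (x i)\<^sup>2) \<le> 1" and y: "(\<Sum>i<n. (y i)\<^sup>2) \<le> 1"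
  shows "bil n (norm_adj n M) x y \<le> 1"
proof -
  let ?D = "row_deg n M"
  have "bil n (norm_adj n M) x y \<le> (\<Sum>i<n. \<Sum>j<n. (M i j * ((x i)\<^sup>2 / ?D i) + M j i * ((y j)\<^sup>2 / ?D j)) / 2)"
    unfolding bil_def
  proof (intro sum_mono)
    fix i j assume "i \<in> {..<n}" "j \<in> {..<n}"
    then have ij: "i < n" "j < n" by auto
    have "norm_adj n M i j * x i * y j = M i j * ((x i / sqrt (?D i)) * (y j / sqrt (?D j)))"
      by (simp add: norm_adj_def)
    also have "\<dots> \<le> M i j * (((x i / sqrt (?D i))\<^sup>2 + (y j / sqrt (?D j))\<^sup>2) / 2)"
      using M ij by (intro mult_left_mono mult_le_half_squares) auto
    also have "\<dots> = (M i j * ((x i)\<^sup>2 / ?D i) + M i j * ((y j)\<^sup>2 / ?D j)) / 2"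
      using deg[OF ij(1)] deg[OF ij(2)] by (simp add: power_divide algebra_simps)
    finally show "norm_adj n M i j * x i * y j \<le> (M i j * ((x i)\<^sup>2 / ?D i) + M j i * ((y j)\<^sup>2 / ?D j)) / 2"
      using M(2)[OF ij] by simp
  qed
  also have "\<dots> = ((\<Sum>i<n. \<Sum>j<n. M i j * ((x i)\<^sup>2 / ?D i)) + (\<Sum>i<n. \<Sum>j<n. M j i * ((y j)\<^sup>2 / ?D j))) / 2"
    by (simp add: sum.distrib flip: sum_divide_distrib)
  also have "(\<Sum>i<n. \<Sum>j<n. M j i * ((y j)\<^sup>2 / ?D j)) = (\<Sum>j<n. \<Sum>i<n. M j i * ((y j)\<^sup>2 / ?D j))"
    by (rule sum.swap)
  also have "(\<Sum>j<n. \<Sum>i<n. M j i * ((y j)\<^sup>2 / ?D j)) = (\<Sum>j<n. (y j)\<^sup>2)"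
  proof (rule sum.cong[OF refl])
    fix j assume "j \<in> {..<n}"
    then have "0 < ?D j" using deg by simp
    then show "(\<Sum>i<n. M j i * ((y j)\<^sup>2 / ?D j)) = (y j)\<^sup>2"
      by (simp only: sum_distrib_right[symmetric] row_deg_def[symmetric]) simp
  qed
  also have "(\<Sum>j<n. \<Sum>i<n. M j i * ((x j)\<^sup>2 / ?D j)) = (\<Sum>j<n. (x j)\<^sup>2)"
  proof (rule sum.cong[OF refl])
    fix j assume "j \<in> {..<n}"
    then have "0 < ?D j" using deg by simp
    then show "(\<Sum>i<n. M j i * ((x j)\<^sup>2 / ?D j)) = (x j)\<^sup>2"
      by (simp only: sum_distrib_right[symmetric] row_deg_def[symmetric]) simp
  qed
  finally show ?thesis using x y by simp
qed

lemma bil_le_of_entries_le: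
  assumes M: "\<And>i j. i < n \<Longrightarrow> j < n \<Longrightarrow> 0 \<le> M i j \<and> M i j \<le> g / real n" and g: "0 \<le> g"
    and x: "(\<Sum>i<n. (x i)\<^sup>2) \<le> 1" and y: "(\<Sum>i<n. (y i)\<^sup>2) \<le> 1"
  shows "bil n M x y \<le> g"
proof -
  have "bil n M x y \<le> (\<Sum>i<n. \<Sum>j<n. g / real n * (((x i)\<^sup>2 + (y j)\<^sup>2) / 2))"
    unfolding bil_def
  proof (intro sum_mono)
    fix i j assume "i \<in> {..<n}" "j \<in> {..<n}"
    then have m: "0 \<le> M i j" "M i j \<le> g / real n" using M by auto
    have "M i j * x i * y j \<le> M i j * (((x i)\<^sup>2 + (y j)\<^sup>2) / 2)"
      unfolding mult.assoc using m by (intro mult_left_mono mult_le_half_squares)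
    also have "\<dots> \<le> g / real n * (((x i)\<^sup>2 + (y j)\<^sup>2) / 2)" using m by (intro mult_right_mono) auto
    finally show "M i j * x i * y j \<le> g / real n * (((x i)\<^sup>2 + (y j)\<^sup>2) / 2)" .
  qed
  also have "\<dots> = g / real n * (real n * ((\<Sum>i<n. (x i)\<^sup>2) + (\<Sum>i<n. (y i)\<^sup>2)) / 2)"
    by (simp only: sum_distrib_left[symmetric] sum_divide_distrib[symmetric] sum.distrib sum_constant)
       (simp add: sum_distrib_left algebra_simps)
  also have "\<dots> \<le> g / real n * (real n * (1 + 1) / 2)"
    using x y g by (intro mult_left_mono divide_right_mono add_mono) auto
  also have "\<dots> \<le> g" using g by simp
  finally show ?thesis .
qed

lemma bil_le_frobenius:
  assumes x: "(\<Sum>i<n. (x i)\<^sup>2) \<le> 1" and y: "(\<Sum>i<n. (y i)\<^sup>2) \<le> 1"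
  shows "bil n M x y \<le> sqrt (\<Sum>i<n. \<Sum>j<n. (M i j)\<^sup>2)"
proof (rule real_le_rsqrt)
  let ?P = "{..<n} \<times> {..<n}"
  have "bil n M x y = (\<Sum>ij\<in>?P. M (fst ij) (snd ij) * (x (fst ij) * y (snd ij)))"
    by (simp add: bil_def sum.cartesian_product case_prod_unfold mult.assoc)
  then have "(bil n M x y)\<^sup>2 \<le> (\<Sum>ij\<in>?P. (M (fst ij) (snd ij))\<^sup>2) * (\<Sum>ij\<in>?P. (x (fst ij) * y (snd ij))\<^sup>2)"
    by (simp only: Cauchy_Schwarz_ineq_sum)
  also have "(\<Sum>ij\<in>?P. (x (fst ij) * y (snd ij))\<^sup>2) = (\<Sum>i<n. (x i)\<^sup>2) * (\<Sum>i<n. (y i)\<^sup>2)"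
    by (simp add: sum_product sum.cartesian_product case_prod_unfold power_mult_distrib)
  also have "(\<Sum>ij\<in>?P. (M (fst ij) (snd ij))\<^sup>2) = (\<Sum>i<n. \<Sum>j<n. (M i j)\<^sup>2)"
    by (simp add: sum.cartesian_product case_prod_unfold)
  also have "(\<Sum>i<n. \<Sum>j<n. (M i j)\<^sup>2) * ((\<Sum>i<n. (x i)\<^sup>2) * (\<Sum>i<n. (y i)\<^sup>2)) \<le> (\<Sum>i<n. \<Sum>j<n. (M i j)\<^sup>2) * (1 * 1)"
    using x y by (intro mult_left_mono mult_mono sum_nonneg) auto
  finally show "(bil n M x y)\<^sup>2 \<le> (\<Sum>i<n. \<Sum>j<n. (M i j)\<^sup>2)" by simp
qed

section \<open>Sensitivity of the degree normalization\<close>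

lemma le_sqrt_self: "0 \<le> t \<Longrightarrow> t \<le> 1 \<Longrightarrow> t \<le> sqrt t"
  by (rule real_le_rsqrt) (simp add: power2_eq_square mult_left_le)

lemma row_deg_reg_adj: "1 \<le> n \<Longrightarrow> row_deg n (reg_adj n \<gamma> M) i = row_deg n M i + \<gamma>"
  by (simp add: row_deg_def reg_adj_def sum.distrib)

text \<open>With \<open>e i = sqrt (D i / (D i + \<gamma>))\<close> the regularized matrix is
  \<open>e N e + R\<close>, where \<open>N\<close> is the normalized matrix and \<open>R\<close> has
  entries at most \<open>g / n\<close> for \<open>g = \<gamma> / (\<delta> + \<gamma>)\<close>.
  Replacing each \<open>e\<close> by the identity costs \<open>g\<close>, because
  \<open>1 - e i \<le> g\<close>, and \<open>R\<close> costs a third \<open>g\<close>. Finally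
  \<open>g \<le> sqrt g\<close>.\<close>

lemma regularization_bias_le:
  assumes n: "1 \<le> n" and M: "\<And>i j. i < n \<Longrightarrow> j < n \<Longrightarrow> 0 \<le> M i j" "\<And>i j. i < n \<Longrightarrow> j < n \<Longrightarrow> M i j = M j i"
    and deg: "\<And>i. i < n \<Longrightarrow> \<delta> \<le> row_deg n M i" and \<delta>: "0 < \<delta>" and \<gamma>: "0 < \<gamma>"
    and x: "(\<Sum>i<n. (x i)\<^sup>2) \<le> 1" and y: "(\<Sum>i<n. (y i)\<^sup>2) \<le> 1"
  shows "bil n (norm_adj n (reg_adj n \<gamma> M)) x y - bil n (norm_adj n M) x y \<le> 3 * sqrt (\<gamma> / (\<delta> + \<gamma>))"
proof -
  define g where "g = \<gamma> / (\<delta> + \<gamma>)"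
  have g: "0 < g" "g \<le> 1" using \<delta> \<gamma> by (auto simp: g_def)
  let ?D = "row_deg n M"
  define e where "e i = sqrt (?D i / (?D i + \<gamma>))" for i
  have D: "0 < ?D i" if "i < n" for i using deg[OF that] \<delta> by simp
  have e: "0 \<le> e i" "e i \<le> 1" "1 - e i \<le> g" if "i < n" for i
  proof -
    let ?t = "?D i / (?D i + \<gamma>)"
    have t: "0 \<le> ?t" "?t \<le> 1" using D[OF that] \<gamma> by auto
    show "0 \<le> e i" "e i \<le> 1" using t by (auto simp: e_def)
    have "?t \<le> sqrt ?t" using t by (rule le_sqrt_self)
    moreover have "1 - ?t = \<gamma> / (?D i + \<gamma>)" using D[OF that] \<gamma> by (simp add: field_simps)
    moreover have "\<gamma> / (?D i + \<gamma>) \<le> g" unfolding g_def using deg[OF that] \<delta> \<gamma> by (intro divide_left_mono) auto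
    ultimately show "1 - e i \<le> g" by (simp add: e_def)
  qed
  let ?R = "\<lambda>i j. (\<gamma> / real n) / (sqrt (?D i + \<gamma>) * sqrt (?D j + \<gamma>))"
  have split: "bil n (norm_adj n (reg_adj n \<gamma> M)) x y = bil n (norm_adj n M) (\<lambda>i. e i * x i) (\<lambda>i. e i * y i) + bil n ?R x y"
    unfolding bil_def sum.distrib[symmetric]
  proof (intro sum.cong refl)
    fix i j assume "i \<in> {..<n}" "j \<in> {..<n}"
    then have "0 < ?D i" "0 < ?D j" using D by auto
    then have "norm_adj n M i j * e i * e j = M i j / (sqrt (?D i + \<gamma>) * sqrt (?D j + \<gamma>))"
      by (simp add: norm_adj_def e_def real_sqrt_divide)
    then have "norm_adj n (reg_adj n \<gamma> M) i j = norm_adj n M i j * e i * e j + ?R i j"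
      unfolding norm_adj_def[of n "reg_adj n \<gamma> M"] row_deg_reg_adj[OF n] by (simp add: reg_adj_def add_divide_distrib)
    then show "norm_adj n (reg_adj n \<gamma> M) i j * x i * y j = 
       norm_adj n M i j * (e i * x i) * (e j * y j) + ?R i j * x i * y j" by (simp add: algebra_simps)
  qed
  \<comment> \<open>Telescoping gives \<open>e N e - N = (e - 1) N e + N (e - 1)\<close>. Division
    by \<open>g\<close> keeps the vectors in the unit ball, so the contraction bound for
    \<open>N\<close> applies to both terms.\<close>
  define u where "u i = ((e i - 1) / g) * x i" for i
  define v where "v i = ((e i - 1) / g) * y i" for i
  have contract: "(\<Sum>i<n. (c i * z i)\<^sup>2) \<le> 1" if "\<And>i. i < n \<Longrightarrow> \<bar>c i\<bar> \<le> 1" "(\<Sum>i<n. (z i)\<^sup>2) \<le> 1" for c z :: "nat \<Rightarrow> real"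
  proof -
    have "(\<Sum>i<n. (c i * z i)\<^sup>2) \<le> (\<Sum>i<n. (z i)\<^sup>2)"
      using that(1) by (intro sum_mono) (auto simp: power_mult_distrib abs_square_le_1 intro!: mult_left_le_one_le)
    then show ?thesis using that(2) by simp
  qed
  have eg: "\<bar>(e i - 1) / g\<bar> \<le> 1" if "i < n" for i
  proof -
    have "\<bar>e i - 1\<bar> \<le> g" using e[OF that] by auto
    then show ?thesis using g by (simp add: abs_divide)
  qed
  have u: "(\<Sum>i<n. (u i)\<^sup>2) \<le> 1" unfolding u_def using eg x by (rule contract)
  have v: "(\<Sum>i<n. (v i)\<^sup>2) \<le> 1" unfolding v_def using eg y by (rule contract)
  have ey: "(\<Sum>i<n. (e i * y i)\<^sup>2) \<le> 1" by (rule contract) (use e y in auto)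
  have "bil n (norm_adj n M) (\<lambda>i. e i * x i) (\<lambda>i. e i * y i) - bil n (norm_adj n M) x y
     = g * bil n (norm_adj n M) u (\<lambda>i. e i * y i) + g * bil n (norm_adj n M) x v"
  proof -
    have gu: "(\<lambda>i. g * u i) = (\<lambda>i. (e i - 1) * x i)" and gv: "(\<lambda>i. g * v i) = (\<lambda>i. (e i - 1) * y i)"
      using g by (auto simp: u_def v_def)
    have u': "g * bil n (norm_adj n M) u w = bil n (norm_adj n M) (\<lambda>i. (e i - 1) * x i) w" for w
      by (simp only: bil_scale_left[symmetric] gu)
    have v': "g * bil n (norm_adj n M) x v = bil n (norm_adj n M) x (\<lambda>i. (e i - 1) * y i)"
      by (simp only: bil_scale_right[symmetric] gv)
    show ?thesis unfolding u' v'
      by (simp add: bil_def algebra_simps sum_subtractf sum.distrib)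
  qed
  also have "\<dots> \<le> g * 1 + g * 1"
    using g M D by (intro add_mono mult_left_mono bil_norm_adj_le_1 u v ey x) auto
  finally have 1: "bil n (norm_adj n M) (\<lambda>i. e i * x i) (\<lambda>i. e i * y i) - bil n (norm_adj n M) x y \<le> 2 * g" by simp
  have 2: "bil n ?R x y \<le> g"
  proof (rule bil_le_of_entries_le[OF _ _ x y])
    fix i j assume ij: "i < n" "j < n"
    have "sqrt (\<delta> + \<gamma>) * sqrt (\<delta> + \<gamma>) \<le> sqrt (?D i + \<gamma>) * sqrt (?D j + \<gamma>)"
      using deg[OF ij(1)] deg[OF ij(2)] \<delta> \<gamma> by (intro mult_mono) auto
    then have le: "\<delta> + \<gamma> \<le> sqrt (?D i + \<gamma>) * sqrt (?D j + \<gamma>)" using \<delta> \<gamma> by simp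
    have "?R i j \<le> (\<gamma> / real n) / (\<delta> + \<gamma>)"
      using le \<delta> \<gamma> by (intro divide_left_mono) (auto intro!: mult_pos_pos)
    moreover have "0 \<le> ?R i j" using le \<delta> \<gamma> by (intro divide_nonneg_nonneg) auto
    ultimately show "0 \<le> ?R i j \<and> ?R i j \<le> g / real n" by (simp add: g_def mult.commute)
  qed (use g in auto)
  have "g \<le> sqrt g" using g by (intro le_sqrt_self) auto
  then show ?thesis using 1 2 split by (simp add: g_def)
qed

text \<open>The constant is the Lipschitz constant of the inverse square root on
  \<open>t \<ge> \<gamma>\<close>; it is read off from
  \<open>a - b = (sqrt a - sqrt b) * (sqrt a + sqrt b)\<close>.\<close>

lemma abs_inverse_sqrt_diff_le:
  assumes "\<gamma> \<le> a" "\<gamma> \<le> b" "0 < \<gamma>"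
  shows "\<bar>1 / sqrt a - 1 / sqrt b\<bar> \<le> \<bar>a - b\<bar> / (2 * \<gamma> * sqrt \<gamma>)"
proof -
  have ab: "0 < a" "0 < b" using assms by auto
  have s: "sqrt \<gamma> \<le> sqrt a" "sqrt \<gamma> \<le> sqrt b" "0 < sqrt \<gamma>" using assms by auto
  have "a - b = (sqrt a - sqrt b) * (sqrt a + sqrt b)" using ab by (simp add: algebra_simps)
  then have 1: "\<bar>a - b\<bar> = \<bar>sqrt a - sqrt b\<bar> * (sqrt a + sqrt b)" using s by (simp add: abs_mult)
  have "1 / sqrt a - 1 / sqrt b = (sqrt b - sqrt a) / (sqrt a * sqrt b)" using ab by (simp add: field_simps)
  then have "\<bar>1 / sqrt a - 1 / sqrt b\<bar> = \<bar>sqrt a - sqrt b\<bar> / (sqrt a * sqrt b)"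
    using ab by (simp add: abs_mult abs_minus_commute)
  also have "\<dots> = \<bar>a - b\<bar> / ((sqrt a + sqrt b) * (sqrt a * sqrt b))"
    unfolding 1 using add_pos_pos[of "sqrt a" "sqrt b"] ab by simp
  finally have eq: "\<bar>1 / sqrt a - 1 / sqrt b\<bar> = \<bar>a - b\<bar> / ((sqrt a + sqrt b) * (sqrt a * sqrt b))" .
  have "(2 * sqrt \<gamma>) * (sqrt \<gamma> * sqrt \<gamma>) \<le> (sqrt a + sqrt b) * (sqrt a * sqrt b)"
    by (intro mult_mono add_nonneg_nonneg mult_nonneg_nonneg) (use s in linarith)+
  then have le: "2 * \<gamma> * sqrt \<gamma> \<le> (sqrt a + sqrt b) * (sqrt a * sqrt b)" using assms by (simp add: mult_ac)
  show ?thesis unfolding eq using le assms by (intro divide_left_mono) (auto intro!: mult_pos_pos add_pos_pos ab)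
qed

lemma abs_inverse_sqrt_prod_diff_le:
  assumes "\<gamma> \<le> a" "\<gamma> \<le> a'" "\<gamma> \<le> b" "\<gamma> \<le> b'" "0 < \<gamma>"
  shows "\<bar>1 / (sqrt a * sqrt b) - 1 / (sqrt a' * sqrt b')\<bar> \<le> (\<bar>a - a'\<bar> + \<bar>b - b'\<bar>) / (2 * \<gamma>\<^sup>2)"
proof -
  have inv: "1 / sqrt t \<le> 1 / sqrt \<gamma>" "0 \<le> 1 / sqrt t" if "\<gamma> \<le> t" for t
    using that assms by (auto intro!: divide_left_mono mult_pos_pos)
  have "1 / (sqrt a * sqrt b) - 1 / (sqrt a' * sqrt b') =
    (1 / sqrt a - 1 / sqrt a') * (1 / sqrt b) + (1 / sqrt a') * (1 / sqrt b - 1 / sqrt b')"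
    by (simp add: algebra_simps)
  also have "\<bar>\<dots>\<bar> \<le> \<bar>1 / sqrt a - 1 / sqrt a'\<bar> * (1 / sqrt b) + (1 / sqrt a') * \<bar>1 / sqrt b - 1 / sqrt b'\<bar>"
    using inv(2)[OF assms(3)] inv(2)[OF assms(2)]
    by (intro order_trans[OF abs_triangle_ineq] add_mono) (auto simp: abs_mult)
  also have "\<dots> \<le> \<bar>a - a'\<bar> / (2 * \<gamma> * sqrt \<gamma>) * (1 / sqrt \<gamma>) + (1 / sqrt \<gamma>) * (\<bar>b - b'\<bar> / (2 * \<gamma> * sqrt \<gamma>))"
    using assms inv by (intro add_mono mult_mono abs_inverse_sqrt_diff_le) auto
  also have "\<dots> = (\<bar>a - a'\<bar> + \<bar>b - b'\<bar>) / (2 * \<gamma>\<^sup>2)"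
    using assms by (simp add: field_simps power2_eq_square)
  finally show ?thesis .
qed

text \<open>The form is linear in each coordinate, so moving a coordinate to the next integer in the
  direction of the sign of its coefficient does not decrease it. First \<open>x\<close> is rounded
  with \<open>y\<close> fixed, then \<open>y\<close> with the rounded \<open>X\<close> fixed. No
  approximation error arises.\<close>

lemma bil_round:
  fixes x y :: "nat \<Rightarrow> real"
  obtains X Y :: "nat \<Rightarrow> int" where "X \<in> extensional {..<n}" "Y \<in> extensional {..<n}"
    "\<And>i. i < n \<Longrightarrow> \<bar>real_of_int (X i)\<bar> \<le> \<bar>x i\<bar> + 1" "\<And>i. i < n \<Longrightarrow> \<bar>real_of_int (Y i)\<bar> \<le> \<bar>y i\<bar> + 1"
    "bil n M x y \<le> bil n M (\<lambda>i. real_of_int (X i)) (\<lambda>i. real_of_int (Y i))"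
proof -
  have round: "\<exists>Z::nat \<Rightarrow> int. Z \<in> extensional {..<n} \<and> (\<forall>i<n. \<bar>real_of_int (Z i)\<bar> \<le> \<bar>z i\<bar> + 1)
      \<and> (\<Sum>i<n. c i * z i) \<le> (\<Sum>i<n. c i * real_of_int (Z i))" for c z :: "nat \<Rightarrow> real"
  proof (intro exI conjI allI impI)
    let ?Z = "restrict (\<lambda>i. if 0 \<le> c i then \<lceil>z i\<rceil> else \<lfloor>z i\<rfloor>) {..<n}"
    show "?Z \<in> extensional {..<n}" by simp
    show "\<bar>real_of_int (?Z i)\<bar> \<le> \<bar>z i\<bar> + 1" if "i < n" for i using that by (auto split: if_splits) linarith+
    show "(\<Sum>i<n. c i * z i) \<le> (\<Sum>i<n. c i * real_of_int (?Z i))"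
      by (intro sum_mono) (auto intro: mult_left_mono mult_left_mono_neg)
  qed
  obtain X where X: "X \<in> extensional {..<n}" "\<forall>i<n. \<bar>real_of_int (X i)\<bar> \<le> \<bar>x i\<bar> + 1"
    "(\<Sum>i<n. (\<Sum>j<n. M i j * y j) * x i) \<le> (\<Sum>i<n. (\<Sum>j<n. M i j * y j) * real_of_int (X i))"
    using round[where c = "\<lambda>i. \<Sum>j<n. M i j * y j" and z = x] by blast
  obtain Y where Y: "Y \<in> extensional {..<n}" "\<forall>i<n. \<bar>real_of_int (Y i)\<bar> \<le> \<bar>y i\<bar> + 1"
    "(\<Sum>j<n. (\<Sum>i<n. M i j * real_of_int (X i)) * y j) \<le> (\<Sum>j<n. (\<Sum>i<n. M i j * real_of_int (X i)) * real_of_int (Y j))"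
    using round[where c = "\<lambda>j. \<Sum>i<n. M i j * real_of_int (X i)" and z = y] by blast
  have l: "bil n M u v = (\<Sum>i<n. (\<Sum>j<n. M i j * v j) * u i)" for u v
    unfolding bil_def sum_distrib_right by (simp add: mult_ac)
  have r: "bil n M u v = (\<Sum>j<n. (\<Sum>i<n. M i j * u i) * v j)" for u v
    unfolding bil_def by (subst sum.swap) (simp add: sum_distrib_right)
  have "bil n M x y \<le> bil n M (\<lambda>i. real_of_int (X i)) y" using X(3) unfolding l .
  also have "\<dots> \<le> bil n M (\<lambda>i. real_of_int (X i)) (\<lambda>i. real_of_int (Y i))" using Y(3) unfolding r .
  finally show ?thesis using that X Y by blast
qed

section \<open>Concentration of the regularized Laplacian\<close>

context inhom_ER
begin

text \<open>Light pairs are kept centered. On heavy pairs the random part is bounded by absolute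
  values, and the expected part by \<open>p i j * \<bar>z\<bar> \<le> z^2 * sqrt d / n\<close>,
  since \<open>\<bar>z\<bar> > sqrt d\<close>; this sums to \<open>16 * sqrt d * n\<close>. The
  total is \<open>58 + 11000 * r\<close>.\<close>

lemma bil_centered_rounded_le:
  assumes A: "A \<in> set_pmf (ER_adj n p)" and light: "light_bounded A" and disc: "discrepancy n d r A" and r: "1 \<le> r"
    and X: "X \<in> lattice_ball n" and Y: "Y \<in> lattice_ball n"
    and dX: "(\<Sum>i<n. row_deg n A i * (real_of_int (X i))\<^sup>2) \<le> 56 * d * real n"
    and dY: "(\<Sum>i<n. row_deg n A i * (real_of_int (Y i))\<^sup>2) \<le> 56 * d * real n"
  shows "bil n (\<lambda>i j. A i j - p i j) (\<lambda>i. real_of_int (X i)) (\<lambda>i. real_of_int (Y i)) \<le> 11100 * r * sqrt d * real n"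
proof -
  have A0: "0 \<le> A i j" for i j by (rule ER_adj_nonneg[OF A])
  have X4: "(\<Sum>i<n. (real_of_int (X i))\<^sup>2) \<le> 4 * real n" and Y4: "(\<Sum>i<n. (real_of_int (Y i))\<^sup>2) \<le> 4 * real n"
    using X Y by (auto simp: lattice_ball_def)
  have sd: "0 < sqrt d" using d_ge_1 by simp
  let ?z = "\<lambda>i j. real_of_int (X i * Y j)"
  have "bil n (\<lambda>i j. A i j - p i j) (\<lambda>i. real_of_int (X i)) (\<lambda>i. real_of_int (Y i))
    \<le> (\<Sum>i<n. \<Sum>j<n. (if \<bar>?z i j\<bar> \<le> sqrt d then (A i j - p i j) * ?z i j else 0)
        + (if sqrt d < \<bar>?z i j\<bar> then A i j * \<bar>?z i j\<bar> else 0)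
        + (real_of_int (X i))\<^sup>2 * (real_of_int (Y j))\<^sup>2 * (sqrt d / real n))"
    unfolding bil_def
  proof (intro sum_mono)
    fix i j assume "i \<in> {..<n}" "j \<in> {..<n}"
    then have ij: "i < n" "j < n" by auto
    have z2: "0 \<le> (real_of_int (X i))\<^sup>2 * (real_of_int (Y j))\<^sup>2 * (sqrt d / real n)" using sd by simp
    have eq: "(A i j - p i j) * real_of_int (X i) * real_of_int (Y j) = (A i j - p i j) * ?z i j" by simp
    show "(A i j - p i j) * real_of_int (X i) * real_of_int (Y j) \<le> 
        (if \<bar>?z i j\<bar> \<le> sqrt d then (A i j - p i j) * ?z i j else 0)
        + (if sqrt d < \<bar>?z i j\<bar> then A i j * \<bar>?z i j\<bar> else 0)
        + (real_of_int (X i))\<^sup>2 * (real_of_int (Y j))\<^sup>2 * (sqrt d / real n)"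
    proof (cases "\<bar>?z i j\<bar> \<le> sqrt d")
      case True
      then show ?thesis unfolding eq using z2 by simp
    next
      case False
      have "\<bar>?z i j\<bar> * sqrt d \<le> \<bar>?z i j\<bar> * \<bar>?z i j\<bar>" using False by (intro mult_left_mono) auto
      then have "\<bar>?z i j\<bar> \<le> (?z i j)\<^sup>2 / sqrt d" using sd by (simp add: pos_le_divide_eq power2_eq_square)
      then have "p i j * \<bar>?z i j\<bar> \<le> d / real n * ((?z i j)\<^sup>2 / sqrt d)"
        using p_le[OF ij] p_nonneg[OF ij] d_ge_1 by (intro mult_mono) auto
      also have "\<dots> = (?z i j)\<^sup>2 * (d / sqrt d) / real n" by (simp add: mult_ac)
      also have "\<dots> = (real_of_int (X i))\<^sup>2 * (real_of_int (Y j))\<^sup>2 * (sqrt d / real n)"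
        using d_ge_1 by (simp add: real_div_sqrt power_mult_distrib)
      finally have 1: "p i j * \<bar>?z i j\<bar> \<le> (real_of_int (X i))\<^sup>2 * (real_of_int (Y j))\<^sup>2 * (sqrt d / real n)" .
      have "A i j * ?z i j \<le> A i j * \<bar>?z i j\<bar>" using A0 by (intro mult_left_mono) auto
      moreover have "p i j * (- ?z i j) \<le> p i j * \<bar>?z i j\<bar>" using p_nonneg[OF ij] by (intro mult_left_mono) auto
      ultimately have "(A i j - p i j) * ?z i j \<le> A i j * \<bar>?z i j\<bar> + p i j * \<bar>?z i j\<bar>" by (simp only: left_diff_distrib)
      then show ?thesis unfolding eq using 1 False by simp
    qed
  qed
  also have "\<dots> = light_sum A X Y + (\<Sum>i<n. \<Sum>j<n. if sqrt d < \<bar>?z i j\<bar> then A i j * \<bar>?z i j\<bar> else 0)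
      + (\<Sum>i<n. (real_of_int (X i))\<^sup>2) * (\<Sum>j<n. (real_of_int (Y j))\<^sup>2) * (sqrt d / real n)"
    by (simp only: sum.distrib light_sum_def sum_product) (simp only: sum_distrib_right)
  also have "\<dots> \<le> 42 * sqrt d * real n + 11000 * r * sqrt d * real n + (4 * real n) * (4 * real n) * (sqrt d / real n)"
  proof (intro add_mono)
    show "light_sum A X Y \<le> 42 * sqrt d * real n" using light X Y by (simp add: light_bounded_def)
    have "(\<Sum>i<n. \<Sum>j<n. A i j * (real_of_int (X i))\<^sup>2) \<le> 56 * d * real n"
      using dX by (simp add: row_deg_def sum_distrib_right)
    moreover have "(\<Sum>i<n. \<Sum>j<n. A i j * (real_of_int (Y j))\<^sup>2) = (\<Sum>i<n. \<Sum>j<n. A j i * (real_of_int (Y j))\<^sup>2)"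
      by (intro sum.cong refl arg_cong2[where f = "(*)"] ER_adj_sym[OF A])
    then have "(\<Sum>i<n. \<Sum>j<n. A i j * (real_of_int (Y j))\<^sup>2) = (\<Sum>j<n. \<Sum>i<n. A j i * (real_of_int (Y j))\<^sup>2)"
      by (rule trans) (rule sum.swap)
    then have "(\<Sum>i<n. \<Sum>j<n. A i j * (real_of_int (Y j))\<^sup>2) \<le> 56 * d * real n"
      using dY by (simp add: row_deg_def sum_distrib_right)
    ultimately show "(\<Sum>i<n. \<Sum>j<n. if sqrt d < \<bar>?z i j\<bar> then A i j * \<bar>?z i j\<bar> else 0) \<le> 11000 * r * sqrt d * real n"
      using n_pos by (intro heavy_sum_le[OF disc _ r d_ge_1 A0 X4 Y4]) auto
    show "(\<Sum>i<n. (real_of_int (X i))\<^sup>2) * (\<Sum>j<n. (real_of_int (Y j))\<^sup>2) * (sqrt d / real n)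
      \<le> (4 * real n) * (4 * real n) * (sqrt d / real n)"
      using X4 Y4 sd by (intro mult_right_mono mult_mono sum_nonneg) auto
  qed
  also have "\<dots> = (58 + 11000 * r) * (sqrt d * real n)" using n_pos by (simp add: algebra_simps)
  also have "\<dots> \<le> (11100 * r) * (sqrt d * real n)" using r sd by (intro mult_right_mono) auto
  finally show ?thesis by (simp add: mult_ac)
qed

text \<open>Take both sets to be all vertices and the tilt \<open>m = 1\<close>; then each entropy
  equals \<open>n\<close>.\<close>

lemma total_degree_le:
  assumes "discrepancy n d r A" "r \<le> d"
  shows "(\<Sum>i<n. row_deg n A i) \<le> 27 * d * real n"
proof -
  have "real 1 * edge_weight A {..<n} {..<n} \<le> 3 / 2 * (d * real (card {..<n}) * real (card {..<n}) / real n) * 2 ^ 1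
        + 12 * r * (entropy n (card {..<n}) + entropy n (card {..<n}))"
    by (rule assms(1)[unfolded discrepancy_def, rule_format]) (use n_pos in \<open>auto simp: lessThan_empty_iff\<close>)
  also have "\<dots> = 3 * d * real n + 24 * (r * real n)" using n_pos by (simp add: entropy_def)
  also have "\<dots> \<le> 3 * d * real n + 24 * (d * real n)" using assms(2) by (intro add_mono mult_left_mono mult_right_mono) auto
  finally show ?thesis by (simp add: edge_weight_def row_deg_def)
qed

text \<open>The factor \<open>s = sqrt (n * \<gamma>)\<close> gives the lifted vector square sum at
  most \<open>n\<close> and degree-weighted square sum at most \<open>n * \<gamma>\<close>. After
  rounding the latter is at most \<open>2 * n * \<gamma> + 2 * 27 * d * n \<le> 56 * d * n\<close>,
  as \<open>\<gamma> \<le> d\<close>. Undoing the lift divides by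
  \<open>n * \<gamma>\<close>.\<close>

lemma bil_centered_le:
  assumes A: "A \<in> set_pmf (ER_adj n p)" and light: "light_bounded A" and disc: "discrepancy n d r A"
    and r: "1 \<le> r" "r \<le> d" and \<gamma>: "0 < \<gamma>" "\<gamma> \<le> d"
    and x: "(\<Sum>i<n. (x i)\<^sup>2) \<le> 1" and y: "(\<Sum>i<n. (y i)\<^sup>2) \<le> 1"
  shows "bil n (\<lambda>i j. (A i j - p i j) / (sqrt (row_deg n A i + \<gamma>) * sqrt (row_deg n A j + \<gamma>))) x y
     \<le> 11100 * r * sqrt d / \<gamma>"
proof -
  let ?D = "row_deg n A"
  have D0: "0 \<le> ?D i" for i by (rule row_deg_ER_adj_nonneg[OF A])
  define s where "s = sqrt (real n * \<gamma>)"
  have s: "0 < s" "s * s = real n * \<gamma>" using n_pos \<gamma> by (auto simp: s_def)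
  define lift where "lift z i = s * (z i / sqrt (?D i + \<gamma>))" for z :: "nat \<Rightarrow> real" and i
  have lift_sq: "(lift z i)\<^sup>2 = real n * \<gamma> * (z i)\<^sup>2 / (?D i + \<gamma>)" for z i
    using D0[of i] \<gamma> s(2) by (simp add: lift_def power_mult_distrib power_divide power2_eq_square[of s])
  have norm: "(lift z i)\<^sup>2 \<le> real n * (z i)\<^sup>2" "?D i * (lift z i)\<^sup>2 \<le> real n * \<gamma> * (z i)\<^sup>2" for z i
  proof -
    have D: "0 < ?D i + \<gamma>" using D0[of i] \<gamma> by simp
    have "real n * (z i)\<^sup>2 * \<gamma> \<le> real n * (z i)\<^sup>2 * (?D i + \<gamma>)" using D0[of i] by (intro mult_left_mono) auto
    then show "(lift z i)\<^sup>2 \<le> real n * (z i)\<^sup>2" unfolding lift_sq using D by (simp add: pos_divide_le_eq mult_ac)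
    have "real n * \<gamma> * (z i)\<^sup>2 * ?D i \<le> real n * \<gamma> * (z i)\<^sup>2 * (?D i + \<gamma>)" using D0[of i] \<gamma> by (intro mult_left_mono) auto
    then show "?D i * (lift z i)\<^sup>2 \<le> real n * \<gamma> * (z i)\<^sup>2" unfolding lift_sq using D by (simp add: pos_divide_le_eq mult_ac)
  qed
  obtain X Y :: "nat \<Rightarrow> int" where XY: "X \<in> extensional {..<n}" "Y \<in> extensional {..<n}"
    "\<And>i. i < n \<Longrightarrow> \<bar>real_of_int (X i)\<bar> \<le> \<bar>lift x i\<bar> + 1" "\<And>i. i < n \<Longrightarrow> \<bar>real_of_int (Y i)\<bar> \<le> \<bar>lift y i\<bar> + 1"
    "bil n (\<lambda>i j. A i j - p i j) (lift x) (lift y) \<le> bil n (\<lambda>i j. A i j - p i j) (\<lambda>i. real_of_int (X i)) (\<lambda>i. real_of_int (Y i))"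
    using bil_round[where n = n and x = "lift x" and y = "lift y" and M = "\<lambda>i j. A i j - p i j"] by blast
  have rounded: "Z \<in> lattice_ball n \<and> (\<Sum>i<n. ?D i * (real_of_int (Z i))\<^sup>2) \<le> 56 * d * real n"
    if Z: "Z \<in> extensional {..<n}" "\<And>i. i < n \<Longrightarrow> \<bar>real_of_int (Z i)\<bar> \<le> \<bar>lift z i\<bar> + 1" and z: "(\<Sum>i<n. (z i)\<^sup>2) \<le> 1"
    for Z :: "nat \<Rightarrow> int" and z
  proof -
    have sq: "(real_of_int (Z i))\<^sup>2 \<le> 2 * (lift z i)\<^sup>2 + 2" if "i < n" for i
    proof -
      have "\<bar>real_of_int (Z i)\<bar>\<^sup>2 \<le> (\<bar>lift z i\<bar> + 1)\<^sup>2" using Z(2)[OF that] by (intro power_mono) auto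
      also have "\<dots> \<le> 2 * (lift z i)\<^sup>2 + 2" using sum_squares_bound[of "\<bar>lift z i\<bar>" 1] by (simp add: power2_sum)
      finally show ?thesis by simp
    qed
    have "(\<Sum>i<n. (real_of_int (Z i))\<^sup>2) \<le> (\<Sum>i<n. 2 * (real n * (z i)\<^sup>2) + 2)"
      using sq norm(1)[of z] by (intro sum_mono) (smt (verit) lessThan_iff)
    also have "\<dots> = 2 * real n * (\<Sum>i<n. (z i)\<^sup>2) + 2 * real n" by (simp add: sum.distrib sum_distrib_left mult_ac)
    also have "\<dots> \<le> 2 * real n * 1 + 2 * real n" using z by (intro add_mono mult_left_mono) auto
    finally have 1: "Z \<in> lattice_ball n" using Z(1) by (simp add: lattice_ball_def PiE_def)
    have "(\<Sum>i<n. ?D i * (real_of_int (Z i))\<^sup>2) \<le> (\<Sum>i<n. 2 * (real n * \<gamma> * (z i)\<^sup>2) + 2 * ?D i)"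
    proof (rule sum_mono)
      fix i assume "i \<in> {..<n}"
      then have "?D i * (real_of_int (Z i))\<^sup>2 \<le> ?D i * (2 * (lift z i)\<^sup>2 + 2)" using sq D0 by (intro mult_left_mono) auto
      also have "\<dots> = 2 * (?D i * (lift z i)\<^sup>2) + 2 * ?D i" by (simp add: algebra_simps)
      also have "\<dots> \<le> 2 * (real n * \<gamma> * (z i)\<^sup>2) + 2 * ?D i" using norm(2)[of i z] by simp
      finally show "?D i * (real_of_int (Z i))\<^sup>2 \<le> 2 * (real n * \<gamma> * (z i)\<^sup>2) + 2 * ?D i" .
    qed
    also have "\<dots> = 2 * real n * \<gamma> * (\<Sum>i<n. (z i)\<^sup>2) + 2 * (\<Sum>i<n. ?D i)"
      by (simp add: sum.distrib sum_distrib_left mult_ac)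
    also have "\<dots> \<le> 2 * real n * d * 1 + 2 * (27 * d * real n)"
      using z \<gamma> d_ge_1 total_degree_le[OF disc r(2)] by (intro add_mono mult_mono sum_nonneg mult_left_mono) auto
    finally show ?thesis using 1 by (simp add: mult_ac)
  qed
  have "bil n (\<lambda>i j. (A i j - p i j) / (sqrt (?D i + \<gamma>) * sqrt (?D j + \<gamma>))) x y
    = bil n (\<lambda>i j. A i j - p i j) (lift x) (lift y) / (real n * \<gamma>)"
    unfolding bil_def sum_divide_distrib s(2)[symmetric] using s(1) by (intro sum.cong refl) (simp add: lift_def)
  also have "\<dots> \<le> 11100 * r * sqrt d * real n / (real n * \<gamma>)"
    using rounded[OF XY(1,3) x] rounded[OF XY(2,4) y] \<gamma> n_pos
    by (intro divide_right_mono order_trans[OF XY(5) bil_centered_rounded_le[OF A light disc r(1)]]) auto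
  also have "\<dots> = 11100 * r * sqrt d / \<gamma>" using n_pos by simp
  finally show ?thesis .
qed

text \<open>Each entry is at most \<open>(d + \<gamma>) / n\<close> times a Lipschitz bound in the
  two degree deviations. The Frobenius norm therefore sees only their sum of squares, which
  \<open>degrees_bounded\<close> controls.\<close>

lemma bil_degree_fluctuation_le:
  assumes A: "A \<in> set_pmf (ER_adj n p)" and deg: "degrees_bounded r A"
    and r: "1 \<le> r" and \<gamma>: "0 < \<gamma>"
    and x: "(\<Sum>i<n. (x i)\<^sup>2) \<le> 1" and y: "(\<Sum>i<n. (y i)\<^sup>2) \<le> 1"
  shows "bil n (\<lambda>i j. (p i j + \<gamma> / real n) * (1 / (sqrt (row_deg n A i + \<gamma>) * sqrt (row_deg n A j + \<gamma>))
        - 1 / (sqrt (row_deg n p i + \<gamma>) * sqrt (row_deg n p j + \<gamma>)))) x y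
     \<le> 23 * r * (d + \<gamma>) * sqrt d / \<gamma>\<^sup>2"
proof -
  let ?D = "row_deg n A" and ?E = "row_deg n p"
  let ?M = "\<lambda>i j. (p i j + \<gamma> / real n) * (1 / (sqrt (?D i + \<gamma>) * sqrt (?D j + \<gamma>)) - 1 / (sqrt (?E i + \<gamma>) * sqrt (?E j + \<gamma>)))"
  let ?\<delta> = "\<lambda>i. ?D i - ?E i"
  have D0: "0 \<le> ?D i" for i by (rule row_deg_ER_adj_nonneg[OF A])
  have E0: "0 \<le> ?E i" if "i < n" for i unfolding row_deg_def using p_nonneg that by (intro sum_nonneg) auto
  define K where "K = ((d + \<gamma>) / real n)\<^sup>2 / (2 * \<gamma> ^ 4)"
  have K: "0 \<le> K" using \<gamma> by (simp add: K_def)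
  have "(\<Sum>i<n. \<Sum>j<n. (?M i j)\<^sup>2) \<le> (\<Sum>i<n. \<Sum>j<n. K * ((?\<delta> i)\<^sup>2 + (?\<delta> j)\<^sup>2))"
  proof (intro sum_mono)
    fix i j assume "i \<in> {..<n}" "j \<in> {..<n}"
    then have ij: "i < n" "j < n" by auto
    have "\<bar>1 / (sqrt (?D i + \<gamma>) * sqrt (?D j + \<gamma>)) - 1 / (sqrt (?E i + \<gamma>) * sqrt (?E j + \<gamma>))\<bar>
       \<le> (\<bar>(?D i + \<gamma>) - (?E i + \<gamma>)\<bar> + \<bar>(?D j + \<gamma>) - (?E j + \<gamma>)\<bar>) / (2 * \<gamma>\<^sup>2)"
      using D0 E0 ij \<gamma> by (intro abs_inverse_sqrt_prod_diff_le) auto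
    moreover have "\<bar>p i j + \<gamma> / real n\<bar> \<le> (d + \<gamma>) / real n"
      using p_nonneg[OF ij] p_le[OF ij] \<gamma> by (simp add: add_divide_distrib)
    ultimately have "\<bar>?M i j\<bar> \<le> (d + \<gamma>) / real n * ((\<bar>?\<delta> i\<bar> + \<bar>?\<delta> j\<bar>) / (2 * \<gamma>\<^sup>2))"
      unfolding abs_mult using d_ge_1 \<gamma> by (intro mult_mono) auto
    then have "\<bar>?M i j\<bar>\<^sup>2 \<le> ((d + \<gamma>) / real n * ((\<bar>?\<delta> i\<bar> + \<bar>?\<delta> j\<bar>) / (2 * \<gamma>\<^sup>2)))\<^sup>2"
      by (intro power_mono) auto
    also have "\<dots> = ((d + \<gamma>) / real n)\<^sup>2 / (4 * \<gamma> ^ 4) * (\<bar>?\<delta> i\<bar> + \<bar>?\<delta> j\<bar>)\<^sup>2"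
      by (simp add: power_mult_distrib power_divide flip: power_mult)
    also have "\<dots> \<le> ((d + \<gamma>) / real n)\<^sup>2 / (4 * \<gamma> ^ 4) * (2 * ((?\<delta> i)\<^sup>2 + (?\<delta> j)\<^sup>2))"
      using sum_squares_bound[of "\<bar>?\<delta> i\<bar>" "\<bar>?\<delta> j\<bar>"] \<gamma> by (intro mult_left_mono) (auto simp: power2_sum)
    also have "\<dots> = K * ((?\<delta> i)\<^sup>2 + (?\<delta> j)\<^sup>2)" by (simp add: K_def add_divide_distrib distrib_left mult_ac)
    finally show "(?M i j)\<^sup>2 \<le> K * ((?\<delta> i)\<^sup>2 + (?\<delta> j)\<^sup>2)" by simp
  qed
  also have "\<dots> = K * (2 * real n * (\<Sum>i<n. (?\<delta> i)\<^sup>2))"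
    by (simp only: sum_distrib_left[symmetric] sum.distrib sum_constant) (simp add: sum_distrib_left mult_ac)
  also have "\<dots> \<le> K * (2 * real n * (528 * r\<^sup>2 * d * real n))"
    using K deg by (intro mult_left_mono) (auto simp: degrees_bounded_def)
  also have "\<dots> = 528 * (r\<^sup>2 * (d + \<gamma>)\<^sup>2 * d / \<gamma> ^ 4)"
  proof -
    define u where "u = (d + \<gamma>)\<^sup>2"
    show ?thesis unfolding K_def power_divide u_def[symmetric]
      using n_pos \<gamma> by (simp add: field_simps power2_eq_square[of "real n"])
  qed
  \<comment> \<open>The constant is raised to the perfect square \<open>529 = 23^2\<close>.\<close>
  also have "\<dots> \<le> 529 * (r\<^sup>2 * (d + \<gamma>)\<^sup>2 * d / \<gamma> ^ 4)" using d_ge_1 \<gamma> by (intro mult_right_mono) auto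
  also have "\<dots> = (23 * r * (d + \<gamma>) * sqrt d / \<gamma>\<^sup>2)\<^sup>2"
    using d_ge_1 by (simp add: power_mult_distrib power_divide flip: power_mult)
  finally have "(\<Sum>i<n. \<Sum>j<n. (?M i j)\<^sup>2) \<le> (23 * r * (d + \<gamma>) * sqrt d / \<gamma>\<^sup>2)\<^sup>2" .
  then have "sqrt (\<Sum>i<n. \<Sum>j<n. (?M i j)\<^sup>2) \<le> 23 * r * (d + \<gamma>) * sqrt d / \<gamma>\<^sup>2"
    using r d_ge_1 \<gamma> by (intro real_le_lsqrt) (auto intro!: sum_nonneg)
  then show ?thesis using bil_le_frobenius[OF x y, of ?M] by linarith
qed

text \<open>The two quarters of \<open>exp (- r)\<close> leave one half for the light pairs, and
  \<open>exp (- n) \<le> exp (- r) * exp (- 1)\<close> because \<open>r + 1 \<le> n\<close>.\<close>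

lemma prob_good_event_ge:
  assumes r: "1 \<le> r" "r + 1 \<le> real n"
    and B: "\<And>A. A \<in> set_pmf (ER_adj n p) \<Longrightarrow> light_bounded A \<Longrightarrow> discrepancy n d r A \<Longrightarrow> degrees_bounded r A \<Longrightarrow> A \<in> B"
  shows "1 - exp (- r) \<le> measure_pmf.prob (ER_adj n p) B"
proof -
  let ?P = "measure_pmf.prob (ER_adj n p)"
  let ?L = "{A. \<not> light_bounded A}" and ?Q = "{A. \<not> discrepancy n d r A}" and ?R = "{A. \<not> degrees_bounded r A}"
  have "?P (- B) \<le> ?P (?L \<union> ?Q \<union> ?R)"
    by (rule measure_pmf.finite_measure_mono_AE) (use B in \<open>auto simp: AE_measure_pmf_iff\<close>)
  also have "\<dots> \<le> ?P ?L + ?P ?Q + ?P ?R"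
    by (intro order_trans[OF measure_Un_le] add_mono) auto
  also have "\<dots> \<le> exp (- real n) + exp (- r) / 4 + exp (- r) / 4"
    by (intro add_mono prob_not_light_bounded prob_not_discrepancy prob_not_degrees_bounded r)
  also have "exp (- real n) \<le> exp (- r) / 2"
  proof -
    have "exp (- real n) \<le> exp (- r) * exp (- 1)" using r by (simp flip: exp_add)
    also have "\<dots> \<le> exp (- r) * (1 / 2)"
      using exp_ge_add_one_self[of 1] by (intro mult_left_mono) (auto simp: exp_minus field_simps)
    finally show ?thesis by simp
  qed
  finally have "?P (- B) \<le> exp (- r)" by simp
  then show ?thesis using measure_pmf.prob_compl[of B "ER_adj n p"] by (simp add: Compl_eq_Diff_UNIV)
qed

end

section \<open>From bilinear forms to Laplacians\<close>

lemma bil_laplacian_diff: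
  "bil n (\<lambda>i j. sym_lap n M i j - sym_lap n N i j) x y = bil n (norm_adj n M) (\<lambda>i. - x i) y - bil n (norm_adj n N) (\<lambda>i. - x i) y"
  unfolding bil_minus_left by (simp add: bil_def sym_lap_def norm_adj_def algebra_simps sum_subtractf)

text \<open>The identity matrices cancel, and the remaining minus sign is moved to \<open>x\<close>,
  which stays in the unit ball.\<close>

lemma spec_norm_laplacian_diff_leI:
  assumes "0 \<le> B"
    and "\<And>x y. (\<Sum>i<n. (x i)\<^sup>2) \<le> 1 \<Longrightarrow> (\<Sum>i<n. (y i)\<^sup>2) \<le> 1 \<Longrightarrow>
      bil n (norm_adj n M) x y - bil n (norm_adj n N) x y \<le> B"
  shows "spec_norm n (\<lambda>i j. sym_lap n M i j - sym_lap n N i j) \<le> B"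
  by (rule spec_norm_leI[OF assms(1)]) (unfold bil_laplacian_diff, intro assms(2), simp_all)

text \<open>The regularized expectation normalized by the random degrees is inserted between the two
  matrices. In the first difference \<open>\<gamma> / n\<close> cancels and leaves
  \<open>A - p\<close>; in the second only the degrees change.\<close>

lemma (in inhom_ER) bil_regularized_diff_le:
  assumes A: "A \<in> set_pmf (ER_adj n p)" and good: "light_bounded A" "discrepancy n d r A" "degrees_bounded r A"
    and r: "1 \<le> r" "r \<le> d" and \<gamma>: "0 < \<gamma>" "\<gamma> \<le> d"
    and x: "(\<Sum>i<n. (x i)\<^sup>2) \<le> 1" and y: "(\<Sum>i<n. (y i)\<^sup>2) \<le> 1"
  shows "bil n (norm_adj n (reg_adj n \<gamma> A)) x y - bil n (norm_adj n (reg_adj n \<gamma> p)) x y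
    \<le> 12000 * r\<^sup>2 / sqrt \<gamma> * (1 + d / \<gamma>) powr (5 / 2)"
proof -
  let ?D = "row_deg n A" and ?E = "row_deg n p"
  have "bil n (norm_adj n (reg_adj n \<gamma> A)) x y - bil n (norm_adj n (reg_adj n \<gamma> p)) x y =
    bil n (\<lambda>i j. (A i j - p i j) / (sqrt (?D i + \<gamma>) * sqrt (?D j + \<gamma>))) x y +
    bil n (\<lambda>i j. (p i j + \<gamma> / real n) * (1 / (sqrt (?D i + \<gamma>) * sqrt (?D j + \<gamma>))
        - 1 / (sqrt (?E i + \<gamma>) * sqrt (?E j + \<gamma>)))) x y"
    unfolding bil_add[symmetric] bil_diff[symmetric]
    by (rule arg_cong[where f = "\<lambda>M. bil n M x y"])
       (simp add: fun_eq_iff norm_adj_def row_deg_reg_adj[OF n_pos] reg_adj_def diff_divide_distrib add_divide_distrib algebra_simps)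
  also have "\<dots> \<le> 11100 * r * sqrt d / \<gamma> + 23 * r * (d + \<gamma>) * sqrt d / \<gamma>\<^sup>2"
    using bil_centered_le[OF A good(1,2) r \<gamma> x y] bil_degree_fluctuation_le[OF A good(3) r(1) \<gamma>(1) x y] by linarith
  also have "\<dots> \<le> 12000 * r\<^sup>2 / sqrt \<gamma> * (1 + d / \<gamma>) powr (5 / 2)"
  proof -
    \<comment> \<open>In terms of \<open>q\<close> the two summands are
      \<open>r * sqrt (d / \<gamma>) / sqrt \<gamma>\<close> and \<open>q\<close> times that, up to
      constants. As \<open>q \<ge> 1\<close> and \<open>r \<ge> 1\<close>, both are raised to
      \<open>r^2 * q powr (5 / 2) / sqrt \<gamma>\<close>, with constant
      \<open>11100 + 23\<close>.\<close>
    define q where "q = 1 + d / \<gamma>"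
    have q: "1 \<le> q" using \<gamma> d_ge_1 by (simp add: q_def)
    have "(5 / 2 :: real) = 2 + 1 / 2" by simp
    then have "q powr (5 / 2) = q powr 2 * q powr (1 / 2)" by (simp only: powr_add)
    then have powr: "q powr (5 / 2) = q\<^sup>2 * sqrt q" using q by (simp add: powr_half_sqrt)
    have sq: "sqrt (d / \<gamma>) \<le> sqrt q" by (simp add: q_def)
    have g: "\<gamma> = sqrt \<gamma> * sqrt \<gamma>" "0 < sqrt \<gamma>" using \<gamma> by auto
    have 1: "sqrt d / \<gamma> = sqrt (d / \<gamma>) / sqrt \<gamma>"
      using \<gamma> by (simp add: real_sqrt_divide)
    have 2: "(d + \<gamma>) * sqrt d / \<gamma>\<^sup>2 = q * (sqrt (d / \<gamma>) / sqrt \<gamma>)"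
      unfolding 1[symmetric] q_def using \<gamma> by (simp add: field_simps power2_eq_square)
    have q2: "q \<le> q\<^sup>2" "1 \<le> q\<^sup>2" using q by (auto simp: self_le_power)
    have "11100 * r * sqrt d / \<gamma> + 23 * r * (d + \<gamma>) * sqrt d / \<gamma>\<^sup>2
       = 11100 * r * (sqrt d / \<gamma>) + 23 * r * ((d + \<gamma>) * sqrt d / \<gamma>\<^sup>2)" by simp
    also have "\<dots> = (11100 * r) * (1 * sqrt (d / \<gamma>)) / sqrt \<gamma> + (23 * r) * (q * sqrt (d / \<gamma>)) / sqrt \<gamma>"
      unfolding 1 2 by simp
    also have "\<dots> \<le> (11100 * r\<^sup>2) * (q\<^sup>2 * sqrt q) / sqrt \<gamma> + (23 * r\<^sup>2) * (q\<^sup>2 * sqrt q) / sqrt \<gamma>"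
      using r q q2 sq \<gamma> d_ge_1 self_le_power[of r 2]
      by (intro add_mono divide_right_mono mult_mono) auto
    also have "\<dots> = 11123 * (r\<^sup>2 * (q\<^sup>2 * sqrt q) / sqrt \<gamma>)" by (simp add: add_divide_distrib algebra_simps)
    also have "\<dots> \<le> 12000 * (r\<^sup>2 * (q\<^sup>2 * sqrt q) / sqrt \<gamma>)"
      using q g by (intro mult_right_mono divide_nonneg_nonneg mult_nonneg_nonneg) auto
    finally show ?thesis unfolding q_def[symmetric] powr by simp
  qed
  finally show ?thesis .
qed

section \<open>Reduction to the range where
  \<open>r + 1 \<le> \<gamma> \<le> d \<le> n\<close>\<close>

theorem mainTheorem8:
  shows "\<exists>C::real. \<forall>(n::nat) (p::nat \<Rightarrow> nat \<Rightarrow> real) (\<gamma>::real) (r::real).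
     n \<ge> 1 \<longrightarrow>
     (\<forall>i<n. \<forall>j<n. 0 \<le> p i j \<and> p i j \<le> 1 \<and> p i j = p j i) \<longrightarrow>
     Min {(\<Sum>j<n. p i j) | i. i < n} > 0 \<longrightarrow>
     \<gamma> > 0 \<longrightarrow> r \<ge> 1 \<longrightarrow>
     (let d = Max {real n * p i j | i j. i < n \<and> j < n};
          dmin = Min {(\<Sum>j<n. p i j) | i. i < n}
      in measure_pmf.prob (ER_adj n p)
           {A. spec_norm n (\<lambda>i j. sym_lap n (reg_adj n \<gamma> A) i j - sym_lap n p i j)
               \<le> C * r\<^sup>2 / sqrt \<gamma> * (1 + d / \<gamma>) powr (5/2) + 3 * sqrt (\<gamma> / (dmin + \<gamma>))}
         \<ge> 1 - exp (- r))"
proof (intro exI[of _ 12000] allI impI)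
  fix n :: nat and p :: "nat \<Rightarrow> nat \<Rightarrow> real" and \<gamma> r :: real
  assume n: "n \<ge> 1" and p: "\<forall>i<n. \<forall>j<n. 0 \<le> p i j \<and> p i j \<le> 1 \<and> p i j = p j i"
    and dmin_pos: "Min {(\<Sum>j<n. p i j) | i. i < n} > 0" and \<gamma>: "\<gamma> > 0" and r: "r \<ge> 1"
  define d where "d = Max {real n * p i j | i j. i < n \<and> j < n}"
  define dmin where "dmin = Min {(\<Sum>j<n. p i j) | i. i < n}"
  define B where "B = 12000 * r\<^sup>2 / sqrt \<gamma> * (1 + d / \<gamma>) powr (5/2) + 3 * sqrt (\<gamma> / (dmin + \<gamma>))"
  define G where "G = {A. spec_norm n (\<lambda>i j. sym_lap n (reg_adj n \<gamma> A) i j - sym_lap n p i j) \<le> B}"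
  have dmin0: "0 < dmin" using dmin_pos by (simp add: dmin_def)
  have fin: "finite {real n * p i j | i j. i < n \<and> j < n}"
    by (rule finite_subset[of _ "(\<lambda>(i, j). real n * p i j) ` ({..<n} \<times> {..<n})"]) auto
  have p_le: "p i j \<le> d / real n" if "i < n" "j < n" for i j
  proof -
    have "real n * p i j \<le> d" unfolding d_def using fin that by (intro Max_ge) auto
    then show ?thesis using n by (simp add: pos_le_divide_eq mult.commute)
  qed
  have "real n * p 0 0 \<in> {real n * p i j | i j. i < n \<and> j < n}" using n by (auto intro!: exI[of _ 0])
  then have "d \<in> {real n * p i j | i j. i < n \<and> j < n}" unfolding d_def using fin by (intro Max_in) blast+
  then have d_le_n: "d \<le> real n" using p by (auto simp: mult_left_le)
  have dmin_le: "dmin \<le> row_deg n p i" if "i < n" for i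
    unfolding dmin_def row_deg_def using that by (intro Min_le) auto
  have "row_deg n p 0 \<le> (\<Sum>j<n. d / real n)"
    unfolding row_deg_def using n by (intro sum_mono p_le) auto
  then have dmin_le_d: "dmin \<le> d" using dmin_le[of 0] n by simp
  have B0: "0 \<le> B" unfolding B_def using \<gamma> dmin0 by simp
  have p_deg: "0 < row_deg n p i" if "i < n" for i using dmin_le[OF that] dmin0 by simp
  have adj: "(0 \<le> A i j) \<and> A i j = A j i" if "A \<in> set_pmf (ER_adj n p)" for A i j
    using that by (auto simp: ER_adj_def adj_of_edges_def min.commute[of i j] max.commute[of i j])
  have "1 - exp (- r) \<le> measure_pmf.prob (ER_adj n p) G"
  \<comment> \<open>For \<open>2 \<le> B\<close> the bound holds for every graph in the support,
    since both normalized matrices have forms of absolute value at most 1.\<close>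
  proof (cases "2 \<le> B")
    case True
    have "A \<in> G" if A: "A \<in> set_pmf (ER_adj n p)" for A
      unfolding G_def mem_Collect_eq
    proof (rule spec_norm_laplacian_diff_leI[OF B0])
      fix x y :: "nat \<Rightarrow> real" assume x: "(\<Sum>i<n. (x i)\<^sup>2) \<le> 1" and y: "(\<Sum>i<n. (y i)\<^sup>2) \<le> 1"
      have "bil n (norm_adj n (reg_adj n \<gamma> A)) x y \<le> 1"
      proof (rule bil_norm_adj_le_1[OF _ _ _ x y])
        show "0 < row_deg n (reg_adj n \<gamma> A) i" for i
          unfolding row_deg_reg_adj[OF n] using adj[OF A] \<gamma> by (simp add: row_deg_def add_nonneg_pos sum_nonneg)
      qed (use adj[OF A] \<gamma> in \<open>auto simp: reg_adj_def\<close>)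
      \<comment> \<open>Negating \<open>x\<close> turns the upper bound for the form into the lower
        bound needed for the subtracted matrix.\<close>
      moreover have "bil n (norm_adj n p) (\<lambda>i. - x i) y \<le> 1"
        by (rule bil_norm_adj_le_1) (use p p_deg x y in auto)
      ultimately show "bil n (norm_adj n (reg_adj n \<gamma> A)) x y - bil n (norm_adj n p) x y \<le> B"
        using True by (simp add: bil_minus_left)
    qed
    then have "measure_pmf.prob (ER_adj n p) G = 1"
      by (subst measure_pmf.prob_eq_1) (auto simp: AE_measure_pmf_iff)
    then show ?thesis by simp
  next
    case False
    have d0: "0 < d" using dmin0 dmin_le_d by simp
    have "0 \<le> 12000 * r\<^sup>2 / sqrt \<gamma> * (1 + d / \<gamma>) powr (5/2)" using \<gamma> by simp
    \<comment> \<open>Both summands of \<open>B\<close> are non-negative, hence below 2. For the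
      bias term, \<open>2 / 3 < sqrt (1 / 2)\<close> gives \<open>\<gamma> < dmin\<close>, and
      \<open>dmin \<le> d\<close>.\<close>
    then have "3 * sqrt (\<gamma> / (dmin + \<gamma>)) < 2" using False unfolding B_def by linarith
    moreover have "2 / 3 < sqrt (1 / 2)" by (rule real_less_rsqrt) (simp add: power2_eq_square)
    ultimately have "sqrt (\<gamma> / (dmin + \<gamma>)) < sqrt (1 / 2)" by linarith
    then have "\<gamma> / (dmin + \<gamma>) < 1 / 2" by (simp only: real_sqrt_less_iff)
    then have "\<gamma> < dmin" using dmin0 \<gamma> by (simp add: divide_less_eq)
    then have \<gamma>d: "\<gamma> \<le> d" using dmin_le_d by simp
    \<comment> \<open>The power in the other summand is at least 1, so
      \<open>6000 * r^2 < sqrt \<gamma>\<close>. Thus \<open>sqrt \<gamma>\<close> exceeds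
      \<open>2 * r\<close> and 1, and
      \<open>\<gamma> \<ge> sqrt \<gamma> > 2 * r \<ge> r + 1\<close>.\<close>
    have "0 \<le> 3 * sqrt (\<gamma> / (dmin + \<gamma>))" using \<gamma> dmin0 by simp
    then have lt2: "12000 * r\<^sup>2 / sqrt \<gamma> * (1 + d / \<gamma>) powr (5/2) < 2" using False unfolding B_def by linarith
    have "1 \<le> (1 + d / \<gamma>) powr (5/2)" using d0 \<gamma> by (intro ge_one_powr_ge_zero) auto
    then have "12000 * r\<^sup>2 / sqrt \<gamma> * 1 \<le> 12000 * r\<^sup>2 / sqrt \<gamma> * (1 + d / \<gamma>) powr (5/2)"
      using \<gamma> by (intro mult_left_mono) auto
    then have "12000 * r\<^sup>2 / sqrt \<gamma> < 2" using lt2 by linarith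
    then have "6000 * r\<^sup>2 < sqrt \<gamma>" using \<gamma> by (simp add: divide_less_eq)
    then have s: "2 * r < sqrt \<gamma>" using self_le_power[of r 2] r by simp
    have "1 \<le> sqrt \<gamma>" using s r by linarith
    from mult_left_mono[OF this, of "sqrt \<gamma>"] have "sqrt \<gamma> * 1 \<le> sqrt \<gamma> * sqrt \<gamma>" using \<gamma> by simp
    moreover have "sqrt \<gamma> * sqrt \<gamma> = \<gamma>" using \<gamma> by simp
    ultimately have r\<gamma>: "r + 1 \<le> \<gamma>" using s r by linarith
    interpret inhom_ER n p d
      by unfold_locales (use n p p_le \<gamma>d r\<gamma> r in auto)
    show ?thesis
    proof (rule prob_good_event_ge[OF r])
      show "r + 1 \<le> real n" using r\<gamma> \<gamma>d d_le_n by linarith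
      fix A assume A: "A \<in> set_pmf (ER_adj n p)" and good: "light_bounded A" "discrepancy n d r A" "degrees_bounded r A"
      have rd: "r \<le> d" using r\<gamma> \<gamma>d by linarith
      show "A \<in> G" unfolding G_def mem_Collect_eq
      proof (rule spec_norm_laplacian_diff_leI[OF B0])
        fix x y :: "nat \<Rightarrow> real" assume x: "(\<Sum>i<n. (x i)\<^sup>2) \<le> 1" and y: "(\<Sum>i<n. (y i)\<^sup>2) \<le> 1"
        have "bil n (norm_adj n (reg_adj n \<gamma> p)) x y - bil n (norm_adj n p) x y \<le> 3 * sqrt (\<gamma> / (dmin + \<gamma>))"
          by (rule regularization_bias_le[OF n p_nonneg p_sym dmin_le dmin0 \<gamma> x y])
        with bil_regularized_diff_le[OF A good r rd \<gamma> \<gamma>d x y]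
        show "bil n (norm_adj n (reg_adj n \<gamma> A)) x y - bil n (norm_adj n p) x y \<le> B"
          unfolding B_def by linarith
      qed
    qed
  qed
  then show "let d = Max {real n * p i j | i j. i < n \<and> j < n};
          dmin = Min {(\<Sum>j<n. p i j) | i. i < n}
      in measure_pmf.prob (ER_adj n p)
           {A. spec_norm n (\<lambda>i j. sym_lap n (reg_adj n \<gamma> A) i j - sym_lap n p i j)
               \<le> 12000 * r\<^sup>2 / sqrt \<gamma> * (1 + d / \<gamma>) powr (5/2) + 3 * sqrt (\<gamma> / (dmin + \<gamma>))}
         \<ge> 1 - exp (- r)"
    unfolding Let_def G_def B_def d_def dmin_def .
qed

end
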